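(* Let the maps $\mathcal M_i,\mathcal H_i$ be continuously differentiable, fix ensemble sizes $N_1,N_2,\ldots\ge2$, and let $X_{0:i|i}^{j,n}$ be the ensemble members generated by the LM-EnKS algorithm (with exact derivatives) and $X_{0:i|i}^{j,n,\tau}$ those generated by the EnKS-4DVAR algorithm with finite difference step $\tau>0$, both defined in the context and run with the same ensemble sizes and the same random perturbations. Then for each iteration $j\ge1$, each time step $i=0,\ldots,k$ and each $n=1,\ldots,N_j$, $$X_{0:i|i}^{j,n,\tau}\to X_{0:i|i}^{j,n}\quad\text{in probability as }\tau\to0,\ \tau>0.$$
   Context: Convergence in probability $X^\tau\to X$ as $\tau\to0$ means: for all $\varepsilon,\tilde\varepsilon>0$ there is $\tau_0>0$ such that $\mathbb P[|X^\tau-X|\le\varepsilon]\ge1-\tilde\varepsilon$ for all $0<\tau<\tau_0$. Data: integers $k,m,d_i\ge1$; continuously differentiable maps $\mathcal M_i:\mathbf R^m\to\mathbf R^m$, $\mathcal H_i:\mathbf R^m\to\mathbf R^{d_i}$ with Jacobians $\mathcal M_i',\mathcal H_i'$; fixed vectors $x_{\mathrm b},\mu_i\in\mathbf R^m$, $y_i\in\mathbf R^{d_i}$; covariance matrices $B,Q_i\in\mathbf R^{m\times m}$ (symmetric positive semidefinite) and $R_i\in\mathbf R^{d_i\times d_i}$ (symmetric positive definite), $i=1,\ldots,k$; a constant $\gamma>0$; a deterministic initial approximation $x_{0:k}^0=(x_0^0,\ldots,x_k^0)$ with $x_i^0\in\mathbf R^m$. Put $$\tilde{\mathcal H}_i(x)=\begin{bmatrix}\mathcal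 H_i(x)\\ x\end{bmatrix},\quad \tilde{\mathcal H}_i'(x)=\begin{bmatrix}\mathcal H_i'(x)\\ I_m\end{bmatrix},\quad \tilde R_i=\begin{bmatrix}R_i&0\\ 0&\frac1\gamma I_m\end{bmatrix}.$$ Random inputs: for $j,n=1,2,\ldots$ and $i=1,\dots,k$, mutually independent random vectors $X_{0|0}^{j,n}\sim N(x_{\mathrm b},B)$, $V_i^{j,n}\sim N(0,Q_i)$, $\tilde W_i^{j,n}\sim N(0,\tilde R_i)$. LM-EnKS algorithm with ensemble sizes $N_1,N_2,\ldots\ge2$: set $\bar X_{0:k|k}^{0,N_0}=x_{0:k}^0$. For $j=1,2,\ldots$ let $z_i$ denote the $i$-th block of $\bar X_{0:k|k}^{j-1,N_{j-1}}$. Start from $X_{0:0|0}^{j,n}=X_{0|0}^{j,n}$, $n=1,\ldots,N_j$. For $i=1,\ldots,k$: with $X_{i-1|i-1}^{j,n}$ the last block of $X_{0:i-1|i-1}^{j,n}$, set $$X_{i|i-1}^{j,n}=\mathcal M_i'(z_{i-1})(X_{i-1|i-1}^{j,n}-z_{i-1})+\mathcal M_i(z_{i-1})+\mu_i+V_i^{j,n};$$ let $X_{0:i|i-1}^{j,n}$ be $X_{0:i-1|i-1}^{j,n}$ with the block $X_{i|i-1}^{j,n}$ appended; let $\bar X_{0:i|i-1}^{j},\bar X_{i|i-1}^{j}$ be the sample means over $n=1,\ldots,N_j$; put $h_i^{j,n}=\tilde{\mathcal H}_i'(z_i)(X_{i|i-1}^{j,n}-\bar X_{i|i-1}^{j})$,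 $\tilde y_i=\begin{bmatrix}y_i\\ z_i\end{bmatrix}$, $$A_i=\frac1{N_j-1}\sum_{n=1}^{N_j}(X_{0:i|i-1}^{j,n}-\bar X_{0:i|i-1}^{j})(h_i^{j,n})^{\mathrm T},\qquad D_i=\frac1{N_j-1}\sum_{n=1}^{N_j}h_i^{j,n}(h_i^{j,n})^{\mathrm T},$$ $$X_{0:i|i}^{j,n}=X_{0:i|i-1}^{j,n}+A_i(D_i+\tilde R_i)^{-1}\left(\tilde y_i-\tilde W_i^{j,n}-\tilde{\mathcal H}_i(z_i)-\tilde{\mathcal H}_i'(z_i)(X_{i|i-1}^{j,n}-z_i)\right).$$ The next iterate is $\bar X_{0:k|k}^{j,N_j}=\frac1{N_j}\sum_{n=1}^{N_j}X_{0:k|k}^{j,n}$. EnKS-4DVAR algorithm with step $\tau>0$: the same algorithm with the same $N_j$ and the same random inputs (in particular $X_{0:0|0}^{j,n,\tau}=X_{0|0}^{j,n}$ and $\bar X_{0:k|k}^{0,N_0,\tau}=x_{0:k}^0$), all computed quantities carrying the additional superscript $\tau$, and with all derivative-vector products replaced by finite differences. That is, with $z_i^\tau$ the $i$-th block of $\bar X_{0:k|k}^{j-1,N_{j-1},\tau}$: $$X_{i|i-1}^{j,n,\tau}=\frac{\mathcal M_i\left(z_{i-1}^\tau+\tau(X_{i-1|i-1}^{j,n,\tau}-z_{i-1}^\tau)\right)-\mathcal M_i(z_{i-1}^\tau)}{\tau}+\mathcal M_i(z_{i-1}^\tau)+\mu_i+V_i^{j,n},$$ $$h_i^{j,n,\tau}=\frac{\tilde{\mathcal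 H}_i\left(z_i^\tau+\tau(X_{i|i-1}^{j,n,\tau}-\bar X_{i|i-1}^{j,\tau})\right)-\tilde{\mathcal H}_i(z_i^\tau)}{\tau},$$ $A_i^\tau,D_i^\tau$ are defined by the same formulas as $A_i,D_i$ from $X_{0:i|i-1}^{j,n,\tau}$ and $h_i^{j,n,\tau}$, $\tilde y_i^\tau=\begin{bmatrix}y_i\\ z_i^\tau\end{bmatrix}$, and $$X_{0:i|i}^{j,n,\tau}=X_{0:i|i-1}^{j,n,\tau}+A_i^\tau(D_i^\tau+\tilde R_i)^{-1}\left(\tilde y_i^\tau-\tilde W_i^{j,n}-\tilde{\mathcal H}_i(z_i^\tau)-\frac{\tilde{\mathcal H}_i\left(z_i^\tau+\tau(X_{i|i-1}^{j,n,\tau}-z_i^\tau)\right)-\tilde{\mathcal H}_i(z_i^\tau)}{\tau}\right),$$ with next iterate $\bar X_{0:k|k}^{j,N_j,\tau}=\frac1{N_j}\sum_{n=1}^{N_j}X_{0:k|k}^{j,n,\tau}$. *)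

theory Defs
  imports
    "HOL-Probability.Probability"
    "Jordan_Normal_Form.Gauss_Jordan_Elimination"
begin

text \<open>
  The dimensions \<open>d i\<close> vary with \<open>i\<close> and the composite states \<open>X\<^bsub>0:i\<^esub>\<close> grow with \<open>i\<close>, so
  dimensions are values: \<open>R\<^sup>n\<close> is \<open>carrier_vec n\<close> and the matrices are those of
  Jordan Normal Form. Names and notation of the type-indexed vectors are switched off.
\<close>

unbundle no vec_syntax and no inner_syntax
hide_type (open) Finite_Cartesian_Product.vec
hide_const (open) Finite_Cartesian_Product.vec Finite_Cartesian_Product.mat

subsection \<open>Euclidean calculus\<close>

definition vnorm :: "real vec \<Rightarrow> real" where
  "vnorm v = sqrt (v \<bullet> v)"

text \<open>\<open>f : R\<^sup>m \<rightarrow> R\<^sup>n\<close> has Frechet derivative \<open>h \<mapsto> J h\<close> at \<open>x\<close>.\<close>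

definition has_jacobian_at :: "nat \<Rightarrow> (real vec \<Rightarrow> real vec) \<Rightarrow> real mat \<Rightarrow> real vec \<Rightarrow> bool" where
  "has_jacobian_at m f J x \<longleftrightarrow>
     (\<forall>e>0. \<exists>\<delta>>0. \<forall>h\<in>carrier_vec m. vnorm h < \<delta> \<longrightarrow>
        vnorm (f (x + h) - f x - J *\<^sub>v h) \<le> e * vnorm h)"

text \<open>\<open>f : R\<^sup>m \<rightarrow> R\<^sup>n\<close> is continuously differentiable with Jacobian \<open>f'\<close>; continuity of the
  matrix-valued map \<open>f'\<close> is continuity of its entries.\<close>

definition C1_map :: "nat \<Rightarrow> nat \<Rightarrow> (real vec \<Rightarrow> real vec) \<Rightarrow> (real vec \<Rightarrow> real mat) \<Rightarrow> bool" where
  "C1_map m n f f' \<longleftrightarrow>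
     (\<forall>x\<in>carrier_vec m. f x \<in> carrier_vec n \<and> f' x \<in> carrier_mat n m \<and> has_jacobian_at m f (f' x) x) \<and>
     (\<forall>p<n. \<forall>q<m. \<forall>x\<in>carrier_vec m. \<forall>e>0. \<exists>\<delta>>0. \<forall>x'\<in>carrier_vec m.
        vnorm (x' - x) < \<delta> \<longrightarrow> \<bar>f' x' $$ (p, q) - f' x $$ (p, q)\<bar> < e)"

definition pos_semidef :: "nat \<Rightarrow> real mat \<Rightarrow> bool" where
  "pos_semidef n A \<longleftrightarrow> A \<in> carrier_mat n n \<and> transpose_mat A = A \<and>
     (\<forall>v\<in>carrier_vec n. v \<bullet> (A *\<^sub>v v) \<ge> 0)"

definition pos_def :: "nat \<Rightarrow> real mat \<Rightarrow> bool" where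
  "pos_def n A \<longleftrightarrow> A \<in> carrier_mat n n \<and> transpose_mat A = A \<and>
     (\<forall>v\<in>carrier_vec n. v \<noteq> 0\<^sub>v n \<longrightarrow> v \<bullet> (A *\<^sub>v v) > 0)"

subsection \<open>Random vectors\<close>

text \<open>The Borel sigma-algebra of \<open>R\<^sup>n\<close>, generated by the half-spaces bounding one coordinate.\<close>

definition vec_borel :: "nat \<Rightarrow> real vec measure" where
  "vec_borel n = sigma (carrier_vec n) {{v \<in> carrier_vec n. v $ p \<le> c} | p c. p < n}"

text \<open>\<open>X \<sim> N(\<mu>, \<Sigma>)\<close>, with \<open>\<Sigma>\<close> possibly singular: every linear functional \<open>a \<bullet> X\<close> is normal with
  mean \<open>a \<bullet> \<mu>\<close> and variance \<open>a \<bullet> \<Sigma> a\<close>, a normal variable of variance 0 being almost surely constant.\<close>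

definition gaussian_vec ::
  "'w measure \<Rightarrow> nat \<Rightarrow> ('w \<Rightarrow> real vec) \<Rightarrow> real vec \<Rightarrow> real mat \<Rightarrow> bool" where
  "gaussian_vec P n X \<mu> \<Sigma> \<longleftrightarrow> X \<in> measurable P (vec_borel n) \<and>
     (\<forall>a\<in>carrier_vec n.
        let \<sigma> = sqrt (a \<bullet> (\<Sigma> *\<^sub>v a)) in
        if \<sigma> = 0 then (AE \<omega> in P. a \<bullet> X \<omega> = a \<bullet> \<mu>)
        else distributed P lborel (\<lambda>\<omega>. a \<bullet> X \<omega>) (normal_density (a \<bullet> \<mu>) \<sigma>))"

definition tends_in_prob_at_0 ::
  "'w measure \<Rightarrow> (real \<Rightarrow> 'w \<Rightarrow> real vec) \<Rightarrow> ('w \<Rightarrow> real vec) \<Rightarrow> bool" where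
  "tends_in_prob_at_0 P X\<tau> X \<longleftrightarrow>
     (\<forall>\<epsilon>>0. \<forall>\<epsilon>'>0. \<exists>\<tau>0>0. \<forall>\<tau>. 0 < \<tau> \<and> \<tau> < \<tau>0 \<longrightarrow>
        measure P {\<omega> \<in> space P. vnorm (X\<tau> \<tau> \<omega> - X \<omega>) \<le> \<epsilon>} \<ge> 1 - \<epsilon>')"

text \<open>One index set for all random inputs, so that their joint independence can be stated;
  the arguments are \<open>j\<close>, \<open>n\<close> and, for the last two, \<open>i\<close>.\<close>

datatype noise_index = Init nat nat | ModelErr nat nat nat | ObsErr nat nat nat

definition noise_indices :: "nat \<Rightarrow> noise_index set" where
  "noise_indices k =
     {Init j n | j n. j \<ge> 1 \<and> n \<ge> 1} \<union>
     {ModelErr j n i | j n i. j \<ge> 1 \<and> n \<ge> 1 \<and> i \<in> {1..k}} \<union>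
     {ObsErr j n i | j n i. j \<ge> 1 \<and> n \<ge> 1 \<and> i \<in> {1..k}}"

fun noise_dim :: "nat \<Rightarrow> (nat \<Rightarrow> nat) \<Rightarrow> noise_index \<Rightarrow> nat" where
  "noise_dim m d (Init j n) = m"
| "noise_dim m d (ModelErr j n i) = m"
| "noise_dim m d (ObsErr j n i) = d i + m"

fun noise ::
  "(nat \<Rightarrow> nat \<Rightarrow> 'w \<Rightarrow> real vec) \<Rightarrow> (nat \<Rightarrow> nat \<Rightarrow> nat \<Rightarrow> 'w \<Rightarrow> real vec) \<Rightarrow>
   (nat \<Rightarrow> nat \<Rightarrow> nat \<Rightarrow> 'w \<Rightarrow> real vec) \<Rightarrow> noise_index \<Rightarrow> 'w \<Rightarrow> real vec" where
  "noise X0 V W (Init j n) = X0 j n"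
| "noise X0 V W (ModelErr j n i) = V j n i"
| "noise X0 V W (ObsErr j n i) = W j n i"

subsection \<open>Observations augmented by the regularization term\<close>

definition aug_obs :: "(real vec \<Rightarrow> real vec) \<Rightarrow> real vec \<Rightarrow> real vec" where
  "aug_obs h x = h x @\<^sub>v x"

definition aug_jac :: "nat \<Rightarrow> (real vec \<Rightarrow> real mat) \<Rightarrow> real vec \<Rightarrow> real mat" where
  "aug_jac m h' x = h' x @\<^sub>r 1\<^sub>m m"

definition aug_cov :: "nat \<Rightarrow> nat \<Rightarrow> real \<Rightarrow> real mat \<Rightarrow> real mat" where
  "aug_cov m r \<gamma> R = four_block_mat R (0\<^sub>m r m) (0\<^sub>m m r) ((1 / \<gamma>) \<cdot>\<^sub>m 1\<^sub>m m)"

subsection \<open>Ensembles\<close>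

text \<open>An ensemble of size \<open>N\<close> is a function of \<open>n \<in> {1..N}\<close>; a composite state is the
  concatenation of its blocks of length \<open>m\<close>, numbered from 0.\<close>

definition block :: "nat \<Rightarrow> nat \<Rightarrow> real vec \<Rightarrow> real vec" where
  "block m i x = vec m (\<lambda>p. x $ (i * m + p))"

definition sample_mean :: "nat \<Rightarrow> nat \<Rightarrow> (nat \<Rightarrow> real vec) \<Rightarrow> real vec" where
  "sample_mean r N X = vec r (\<lambda>p. (\<Sum>n=1..N. X n $ p) / real N)"

text \<open>\<open>(N - 1)\<^sup>-\<^sup>1 \<Sum>\<^sub>n U\<^sub>n T\<^sub>n\<^sup>T\<close>, an \<open>r \<times> c\<close> matrix.\<close>

definition sample_outer ::
  "nat \<Rightarrow> nat \<Rightarrow> nat \<Rightarrow> (nat \<Rightarrow> real vec) \<Rightarrow> (nat \<Rightarrow> real vec) \<Rightarrow> real mat" where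
  "sample_outer r c N U T = mat r c (\<lambda>(p, q). (\<Sum>n=1..N. U n $ p * T n $ q) / (real N - 1))"

text \<open>
  Both algorithms are instances of one scheme. It takes as arguments \<open>dM i z u\<close> and \<open>dH i z u\<close>
  standing for the products of \<open>\<M>\<^sub>i'(z)\<close> and of the augmented \<open>\<H>\<^sub>i'(z)\<close> with \<open>u\<close>.
\<close>

context
  fixes m :: nat and d :: "nat \<Rightarrow> nat"
    and \<M> \<H> :: "nat \<Rightarrow> real vec \<Rightarrow> real vec"
    and \<mu> y :: "nat \<Rightarrow> real vec" and R :: "nat \<Rightarrow> real mat" and \<gamma> :: real
begin

definition forecast ::
  "(nat \<Rightarrow> real vec \<Rightarrow> real vec \<Rightarrow> real vec) \<Rightarrow> nat \<Rightarrow> real vec \<Rightarrow> real vec \<Rightarrow> real vec \<Rightarrow> real vec" where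
  "forecast dM i z v x =
     dM i (block m (i - 1) z) (block m (i - 1) x - block m (i - 1) z)
       + \<M> i (block m (i - 1) z) + \<mu> i + v"

text \<open>\<open>X\<close> is the ensemble \<open>X\<^bsub>0:i|i-1\<^esub>\<close> and \<open>zi\<close> the linearization point at time \<open>i\<close>.\<close>

definition analysis ::
  "(nat \<Rightarrow> real vec \<Rightarrow> real vec \<Rightarrow> real vec) \<Rightarrow> nat \<Rightarrow> nat \<Rightarrow> real vec \<Rightarrow>
   (nat \<Rightarrow> real vec) \<Rightarrow> (nat \<Rightarrow> real vec) \<Rightarrow> nat \<Rightarrow> real vec" where
  "analysis dH i N zi w X =
     (let s = (i + 1) * m;
          Xbar = sample_mean s N X;
          F = (\<lambda>n. block m i (X n));
          Fbar = sample_mean m N F;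
          h = (\<lambda>n. dH i zi (F n - Fbar));
          A = sample_outer s (d i + m) N (\<lambda>n. X n - Xbar) h;
          D = sample_outer (d i + m) (d i + m) N h h
      in (\<lambda>n. X n + A *\<^sub>v (the (mat_inverse (D + aug_cov m (d i) \<gamma> (R i))) *\<^sub>v
                ((y i @\<^sub>v zi) - w n - aug_obs (\<H> i) zi - dH i zi (F n - zi)))))"

text \<open>\<open>ensemble dM dH N z x v w i n\<close> is \<open>X\<^bsub>0:i|i\<^esub>\<^sup>n\<close> for one pass with ensemble size \<open>N\<close>, linearized
  at the composite state \<open>z\<close>, with random inputs \<open>x n\<close>, \<open>v n i\<close>, \<open>w n i\<close>.\<close>

primrec ensemble ::
  "(nat \<Rightarrow> real vec \<Rightarrow> real vec \<Rightarrow> real vec) \<Rightarrow> (nat \<Rightarrow> real vec \<Rightarrow> real vec \<Rightarrow> real vec) \<Rightarrow>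
   nat \<Rightarrow> real vec \<Rightarrow> (nat \<Rightarrow> real vec) \<Rightarrow> (nat \<Rightarrow> nat \<Rightarrow> real vec) \<Rightarrow> (nat \<Rightarrow> nat \<Rightarrow> real vec) \<Rightarrow>
   nat \<Rightarrow> nat \<Rightarrow> real vec" where
  "ensemble dM dH N z x v w 0 = x"
| "ensemble dM dH N z x v w (Suc i) =
     (let E = ensemble dM dH N z x v w i;
          X = (\<lambda>n. E n @\<^sub>v forecast dM (Suc i) z (v n (Suc i)) (E n))
      in analysis dH (Suc i) N (block m (Suc i) z) (\<lambda>n. w n (Suc i)) X)"

text \<open>The iterates \<open>j = 0, 1, \<dots>\<close> and the ensemble members \<open>X\<^bsub>0:i|i\<^esub>\<^bsup>j,n\<^esup>\<close> (\<open>j \<ge> 1\<close>), for given values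
  \<open>x j n\<close>, \<open>v j n i\<close>, \<open>w j n i\<close> of the random inputs.\<close>

primrec iterate ::
  "(nat \<Rightarrow> real vec \<Rightarrow> real vec \<Rightarrow> real vec) \<Rightarrow> (nat \<Rightarrow> real vec \<Rightarrow> real vec \<Rightarrow> real vec) \<Rightarrow>
   nat \<Rightarrow> (nat \<Rightarrow> nat) \<Rightarrow> real vec \<Rightarrow> (nat \<Rightarrow> nat \<Rightarrow> real vec) \<Rightarrow>
   (nat \<Rightarrow> nat \<Rightarrow> nat \<Rightarrow> real vec) \<Rightarrow> (nat \<Rightarrow> nat \<Rightarrow> nat \<Rightarrow> real vec) \<Rightarrow> nat \<Rightarrow> real vec" where
  "iterate dM dH k N z0 x v w 0 = z0"
| "iterate dM dH k N z0 x v w (Suc j) =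
     sample_mean ((k + 1) * m) (N (Suc j))
       (ensemble dM dH (N (Suc j)) (iterate dM dH k N z0 x v w j)
          (x (Suc j)) (v (Suc j)) (w (Suc j)) k)"

definition analysis_member ::
  "(nat \<Rightarrow> real vec \<Rightarrow> real vec \<Rightarrow> real vec) \<Rightarrow> (nat \<Rightarrow> real vec \<Rightarrow> real vec \<Rightarrow> real vec) \<Rightarrow>
   nat \<Rightarrow> (nat \<Rightarrow> nat) \<Rightarrow> real vec \<Rightarrow> (nat \<Rightarrow> nat \<Rightarrow> real vec) \<Rightarrow>
   (nat \<Rightarrow> nat \<Rightarrow> nat \<Rightarrow> real vec) \<Rightarrow> (nat \<Rightarrow> nat \<Rightarrow> nat \<Rightarrow> real vec) \<Rightarrow>
   nat \<Rightarrow> nat \<Rightarrow> nat \<Rightarrow> real vec" where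
  "analysis_member dM dH k N z0 x v w j i n =
     ensemble dM dH (N j) (iterate dM dH k N z0 x v w (j - 1)) (x j) (v j) (w j) i n"

definition lm_enks_member ::
  "(nat \<Rightarrow> real vec \<Rightarrow> real mat) \<Rightarrow> (nat \<Rightarrow> real vec \<Rightarrow> real mat) \<Rightarrow>
   nat \<Rightarrow> (nat \<Rightarrow> nat) \<Rightarrow> real vec \<Rightarrow> (nat \<Rightarrow> nat \<Rightarrow> real vec) \<Rightarrow>
   (nat \<Rightarrow> nat \<Rightarrow> nat \<Rightarrow> real vec) \<Rightarrow> (nat \<Rightarrow> nat \<Rightarrow> nat \<Rightarrow> real vec) \<Rightarrow>
   nat \<Rightarrow> nat \<Rightarrow> nat \<Rightarrow> real vec" where
  "lm_enks_member \<M>' \<H>' =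
     analysis_member (\<lambda>i z u. \<M>' i z *\<^sub>v u) (\<lambda>i z u. aug_jac m (\<H>' i) z *\<^sub>v u)"

definition finite_diff :: "real \<Rightarrow> (real vec \<Rightarrow> real vec) \<Rightarrow> real vec \<Rightarrow> real vec \<Rightarrow> real vec" where
  "finite_diff \<tau> f z u = (1 / \<tau>) \<cdot>\<^sub>v (f (z + \<tau> \<cdot>\<^sub>v u) - f z)"

definition enks_4dvar_member ::
  "real \<Rightarrow> nat \<Rightarrow> (nat \<Rightarrow> nat) \<Rightarrow> real vec \<Rightarrow> (nat \<Rightarrow> nat \<Rightarrow> real vec) \<Rightarrow>
   (nat \<Rightarrow> nat \<Rightarrow> nat \<Rightarrow> real vec) \<Rightarrow> (nat \<Rightarrow> nat \<Rightarrow> nat \<Rightarrow> real vec) \<Rightarrow>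
   nat \<Rightarrow> nat \<Rightarrow> nat \<Rightarrow> real vec" where
  "enks_4dvar_member \<tau> =
     analysis_member (\<lambda>i. finite_diff \<tau> (\<M> i)) (\<lambda>i. finite_diff \<tau> (aug_obs (\<H> i)))"

end

end

theory Submission
  imports Defs "Jordan_Normal_Form.Determinant"
begin

text \<open>
  For every fixed outcome of the random inputs, each quantity computed with step \<open>\<tau>\<close> tends to its
  counterpart with exact derivatives as \<open>\<tau> \<rightarrow> 0\<close>; dominated convergence of the indicators then gives
  convergence in probability. Apart from the difference quotients, the algorithm consists of continuous
  operations. The only division that matters is the inversion of \<open>D + R\<close>, and this matrix is the
  sum of a positive semidefinite and a positive definite one, hence invertible both for \<open>\<tau> > 0\<close> and in
  the limit; by the adjugate formula its inverse depends continuously on its entries.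
\<close>

subsection \<open>The Euclidean norm and continuity\<close>

text \<open>The obstacle is that nothing on the side of the step \<tau> stays fixed: ensembles, gain
  matrices and linearization points all depend on \<tau>, and the linearization point of one pass is
  an output of the previous pass. Each stage is therefore shown to send converging inputs to
  converging outputs, instead of converging at a fixed argument. In this form the stages compose, by
  induction over the time steps inside a pass and then over the passes. The inner induction treats
  all members at once, since the gain depends on the whole ensemble.

  Dimensions are values, so convergence and measurability are both expressed through real entries.
  The side conditions are imposed for every \<tau> > 0 and not just for small \<tau>: the threshold
  for "small" would depend on the outcome, whereas measurability concerns one \<tau> and all
  outcomes together. This is why invertibility is needed at every step size and cannot be inherited
  from the limit.\<close>

lemma vnorm_eq_sum: "v \<in> carrier_vec n \<Longrightarrow> vnorm v = sqrt (\<Sum>p<n. (v $ p)\<^sup>2)"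
  by (simp add: vnorm_def scalar_prod_def power2_eq_square lessThan_atLeast0)

lemma vnorm_nonneg: "vnorm v \<ge> 0"
  by (simp add: vnorm_def scalar_prod_def sum_nonneg)

lemma abs_index_le_vnorm:
  assumes "v \<in> carrier_vec n" "p < n"
  shows "\<bar>v $ p\<bar> \<le> vnorm v"
proof -
  have "(v $ p)\<^sup>2 \<le> (\<Sum>p<n. (v $ p)\<^sup>2)"
    using assms by (intro member_le_sum) auto
  then show ?thesis
    using assms by (simp add: vnorm_eq_sum real_le_rsqrt)
qed

lemma vnorm_smult: "vnorm (c \<cdot>\<^sub>v v) = \<bar>c\<bar> * vnorm v"
proof -
  have "(c \<cdot>\<^sub>v v) \<bullet> (c \<cdot>\<^sub>v v) = c\<^sup>2 * (v \<bullet> v)"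
    by (simp add: scalar_prod_def sum_distrib_left power2_eq_square algebra_simps)
  then show ?thesis
    by (simp add: vnorm_def real_sqrt_mult)
qed

lemma index_mult_mat_vec_sum:
  assumes "A \<in> carrier_mat r c" "v \<in> carrier_vec c" "p < r"
  shows "(A *\<^sub>v v) $ p = (\<Sum>q<c. A $$ (p, q) * v $ q)"
  using assms by (simp add: scalar_prod_def lessThan_atLeast0)

text \<open>Phrased exactly like the clause of \<open>C1_map\<close> on Jacobian entries, so that
  this clause is an instance by unfolding.\<close>

definition vcontinuous :: "nat \<Rightarrow> (real vec \<Rightarrow> real) \<Rightarrow> bool" where
  "vcontinuous m f \<longleftrightarrow> (\<forall>x\<in>carrier_vec m. \<forall>e>0. \<exists>\<delta>>0. \<forall>x'\<in>carrier_vec m.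
     vnorm (x' - x) < \<delta> \<longrightarrow> \<bar>f x' - f x\<bar> < e)"

lemma tendsto_vnorm_diff:
  assumes "\<And>p. p < n \<Longrightarrow> ((\<lambda>t. X t $ p) \<longlongrightarrow> L $ p) F"
    and "\<forall>\<^sub>F t in F. X t \<in> carrier_vec n" and "L \<in> carrier_vec n"
  shows "((\<lambda>t. vnorm (X t - L)) \<longlongrightarrow> 0) F"
proof -
  have "((\<lambda>t. sqrt (\<Sum>p<n. (X t $ p - L $ p)\<^sup>2)) \<longlongrightarrow> sqrt (\<Sum>p<n. (L $ p - L $ p)\<^sup>2)) F"
    by (intro tendsto_intros) (use assms in auto)
  then have "((\<lambda>t. sqrt (\<Sum>p<n. (X t $ p - L $ p)\<^sup>2)) \<longlongrightarrow> 0) F"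
    by simp
  moreover have "\<forall>\<^sub>F t in F. sqrt (\<Sum>p<n. (X t $ p - L $ p)\<^sup>2) = vnorm (X t - L)"
    using assms(2) by eventually_elim (use assms(3) in \<open>simp add: vnorm_eq_sum[of _ n]\<close>)
  ultimately show ?thesis
    by (rule Lim_transform_eventually)
qed

lemma vcontinuous_tendsto:
  assumes f: "vcontinuous m f"
    and X: "\<And>p. p < m \<Longrightarrow> ((\<lambda>t. X t $ p) \<longlongrightarrow> L $ p) F" "\<forall>\<^sub>F t in F. X t \<in> carrier_vec m"
    and L: "L \<in> carrier_vec m"
  shows "((\<lambda>t. f (X t)) \<longlongrightarrow> f L) F"
proof (rule tendstoI)
  fix e :: real assume "e > 0"
  with f L obtain \<delta> where \<delta>: "\<delta> > 0"
    "\<And>x'. x' \<in> carrier_vec m \<Longrightarrow> vnorm (x' - L) < \<delta> \<Longrightarrow> \<bar>f x' - f L\<bar> < e"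
    unfolding vcontinuous_def by metis
  have "\<forall>\<^sub>F t in F. vnorm (X t - L) < \<delta>"
    using tendsto_vnorm_diff[OF X L] \<delta>(1) by (rule order_tendstoD(2))
  with X(2) show "\<forall>\<^sub>F t in F. dist (f (X t)) (f L) < e"
    by eventually_elim (simp add: \<delta>(2) dist_real_def)
qed

text \<open>Composed with \<open>Matrix.vec m\<close>, the map \<open>f\<close> becomes a continuous
  function on the product space of all real sequences. There continuity gives Borel measurability,
  and a map into the space is measurable as soon as its coordinates are.\<close>

lemma vcontinuous_measurable:
  assumes f: "vcontinuous m f"
    and X: "\<And>\<omega>. \<omega> \<in> space P \<Longrightarrow> X \<omega> \<in> carrier_vec m"
    and meas: "\<And>p. p < m \<Longrightarrow> (\<lambda>\<omega>. X \<omega> $ p) \<in> borel_measurable P"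
  shows "(\<lambda>\<omega>. f (X \<omega>)) \<in> borel_measurable P"
proof -
  define g :: "(nat \<Rightarrow> real) \<Rightarrow> real" where "g a = f (Matrix.vec m a)" for a
  have "continuous_on UNIV g"
    unfolding continuous_on_def g_def
  proof (intro ballI vcontinuous_tendsto[OF f])
    fix a :: "nat \<Rightarrow> real" and p assume "p < m"
    have "continuous_on UNIV (\<lambda>x :: nat \<Rightarrow> real. x p)"
      by simp
    then have "((\<lambda>x :: nat \<Rightarrow> real. x p) \<longlongrightarrow> a p) (at a)"
      by (simp add: continuous_on_def)
    then show "((\<lambda>x. Matrix.vec m x $ p) \<longlongrightarrow> Matrix.vec m a $ p) (at a)"
      using \<open>p < m\<close> by simp
  qed auto
  then have "g \<in> borel_measurable borel"
    by (rule borel_measurable_continuous_onI)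
  \<comment> \<open>Entries of \<open>X \<omega>\<close> at positions from \<open>m\<close> on are
    unspecified, so they are padded with 0; \<open>Matrix.vec m\<close> discards them again.\<close>
  moreover have "(\<lambda>\<omega> p. if p < m then X \<omega> $ p else 0) \<in> borel_measurable P"
  proof (rule measurable_coordinatewise_then_product)
    fix p show "(\<lambda>\<omega>. if p < m then X \<omega> $ p else 0) \<in> borel_measurable P"
      using meas by (cases "p < m") auto
  qed
  ultimately have "(\<lambda>\<omega>. g (\<lambda>p. if p < m then X \<omega> $ p else 0)) \<in> borel_measurable P"
    by (rule measurable_compose[rotated])
  moreover have "g (\<lambda>p. if p < m then X \<omega> $ p else 0) = f (X \<omega>)" if "\<omega> \<in> space P" for \<omega>
  proof -
    have "Matrix.vec m (\<lambda>p. if p < m then X \<omega> $ p else 0) = X \<omega>"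
      using X[OF that] by (intro eq_vecI) auto
    then show ?thesis
      by (simp add: g_def)
  qed
  ultimately show ?thesis
    by (simp cong: measurable_cong)
qed

lemma C1_mapD:
  assumes "C1_map m n f f'" "x \<in> carrier_vec m"
  shows "f x \<in> carrier_vec n" "f' x \<in> carrier_mat n m" "has_jacobian_at m f (f' x) x"
  using assms by (auto simp: C1_map_def)

lemma C1_map_jacobian_continuous:
  "C1_map m n f f' \<Longrightarrow> p < n \<Longrightarrow> q < m \<Longrightarrow> vcontinuous m (\<lambda>x. f' x $$ (p, q))"
  by (auto simp: C1_map_def vcontinuous_def)

text \<open>Differentiability with tolerance 1 bounds the linearization error by
  \<open>vnorm h\<close>, and the linear part of component \<open>p\<close> is at most
  \<open>?S * vnorm h\<close>, where \<open>?S\<close> is the absolute sum of row \<open>p\<close>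
  of the Jacobian. The increment is thus at most \<open>(1 + ?S) * vnorm h\<close>, which dictates
  the radius.\<close>

lemma C1_map_continuous:
  assumes C1: "C1_map m n f f'" and p: "p < n"
  shows "vcontinuous m (\<lambda>x. f x $ p)"
  unfolding vcontinuous_def
proof (intro ballI allI impI)
  fix x :: "real vec" and e :: real assume x: "x \<in> carrier_vec m" and e: "e > 0"
  let ?S = "\<Sum>q<m. \<bar>f' x $$ (p, q)\<bar>"
  have S: "1 + ?S > 0"
    using sum_nonneg[of "{..<m}" "\<lambda>q. \<bar>f' x $$ (p, q)\<bar>"] by linarith
  obtain \<delta> where \<delta>: "\<delta> > 0"
    "\<And>h. h \<in> carrier_vec m \<Longrightarrow> vnorm h < \<delta> \<Longrightarrow> vnorm (f (x + h) - f x - f' x *\<^sub>v h) \<le> 1 * vnorm h"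
    using C1_mapD(3)[OF C1 x, unfolded has_jacobian_at_def, THEN spec, of 1] by auto
  show "\<exists>\<delta>>0. \<forall>x'\<in>carrier_vec m. vnorm (x' - x) < \<delta> \<longrightarrow> \<bar>f x' $ p - f x $ p\<bar> < e"
  proof (intro exI[of _ "min \<delta> (e / (1 + ?S))"] conjI ballI impI)
    show "min \<delta> (e / (1 + ?S)) > 0"
      using \<delta>(1) e S by simp
    fix x' assume x': "x' \<in> carrier_vec m" and close: "vnorm (x' - x) < min \<delta> (e / (1 + ?S))"
    define h where "h = x' - x"
    have h: "h \<in> carrier_vec m" "x + h = x'"
      using x x' by (auto simp: h_def)
    have car: "f x' \<in> carrier_vec n" "f x \<in> carrier_vec n" "f' x \<in> carrier_mat n m"
      using C1_mapD[OF C1] x x' by auto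
    have "\<bar>(f x' - f x - f' x *\<^sub>v h) $ p\<bar> \<le> vnorm (f x' - f x - f' x *\<^sub>v h)"
      using car p h by (intro abs_index_le_vnorm) auto
    also have "\<dots> \<le> vnorm h"
      using \<delta>(2)[OF h(1)] close h(2) by (simp add: h_def)
    finally have 1: "\<bar>f x' $ p - f x $ p - (\<Sum>q<m. f' x $$ (p, q) * h $ q)\<bar> \<le> vnorm h"
      using car p h by (simp add: scalar_prod_def lessThan_atLeast0)
    have "\<bar>\<Sum>q<m. f' x $$ (p, q) * h $ q\<bar> \<le> (\<Sum>q<m. \<bar>f' x $$ (p, q)\<bar> * vnorm h)"
      using abs_index_le_vnorm[OF h(1)]
      by (intro order.trans[OF sum_abs] sum_mono) (simp add: abs_mult mult_left_mono)
    with 1 have "\<bar>f x' $ p - f x $ p\<bar> \<le> (1 + ?S) * vnorm h"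
      by (simp add: algebra_simps sum_distrib_left sum_distrib_right)
    also have "\<dots> < e"
      using close S by (simp add: h_def field_simps)
    finally show "\<bar>f x' $ p - f x $ p\<bar> < e" .
  qed
qed

subsection \<open>Finite differences\<close>

text \<open>Increments along the line are multiples of \<open>u\<close> by \<open>h\<close>, of norm
  \<open>\<bar>h\<bar> * vnorm u\<close>. A linearization error of \<open>e\<close> times this norm
  becomes at most \<open>e * vnorm u\<close> after division by \<open>h\<close>.\<close>

lemma has_jacobian_at_line:
  assumes f: "\<And>x. x \<in> carrier_vec m \<Longrightarrow> f x \<in> carrier_vec n" and J: "J \<in> carrier_mat n m"
    and jac: "has_jacobian_at m f J (z + t \<cdot>\<^sub>v u)"
    and z: "z \<in> carrier_vec m" and u: "u \<in> carrier_vec m" and p: "p < n"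
  shows "((\<lambda>t. f (z + t \<cdot>\<^sub>v u) $ p) has_real_derivative (J *\<^sub>v u) $ p) (at t)"
  unfolding DERIV_def LIM_eq
proof (intro allI impI)
  fix r :: real assume r: "r > 0"
  \<comment> \<open>The summand 1 covers \<open>u = 0\<close> and keeps \<open>e * vnorm u\<close>
    strictly below \<open>r\<close>; the radius \<open>\<delta> / (1 + vnorm u)\<close> below is
    formed in the same way.\<close>
  define e where "e = r / (2 * (1 + vnorm u))"
  have u1: "1 + vnorm u > 0"
    using vnorm_nonneg[of u] by linarith
  then have e: "e > 0" "e * vnorm u < r"
    using r vnorm_nonneg[of u] by (auto simp: e_def field_simps) (smt (verit) mult_nonneg_nonneg)
  then obtain \<delta> where \<delta>: "\<delta> > 0" "\<And>h. h \<in> carrier_vec m \<Longrightarrow> vnorm h < \<delta> \<Longrightarrow>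
      vnorm (f (z + t \<cdot>\<^sub>v u + h) - f (z + t \<cdot>\<^sub>v u) - J *\<^sub>v h) \<le> e * vnorm h"
    using jac unfolding has_jacobian_at_def by metis
  show "\<exists>s>0. \<forall>h. h \<noteq> 0 \<and> norm (h - 0) < s \<longrightarrow>
    norm ((f (z + (t + h) \<cdot>\<^sub>v u) $ p - f (z + t \<cdot>\<^sub>v u) $ p) / h - (J *\<^sub>v u) $ p) < r"
  proof (intro exI[of _ "\<delta> / (1 + vnorm u)"] conjI allI impI)
    show "\<delta> / (1 + vnorm u) > 0"
      using \<delta>(1) u1 by simp
    fix h :: real assume h: "h \<noteq> 0 \<and> norm (h - 0) < \<delta> / (1 + vnorm u)"
    have eq: "z + (t + h) \<cdot>\<^sub>v u = z + t \<cdot>\<^sub>v u + h \<cdot>\<^sub>v u"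
      using z u by (intro eq_vecI) (auto simp: algebra_simps)
    have "\<bar>h\<bar> * (1 + vnorm u) < \<delta>"
      using h u1 by (simp add: field_simps)
    then have "vnorm (h \<cdot>\<^sub>v u) < \<delta>"
      by (simp add: vnorm_smult algebra_simps)
    then have "vnorm (f (z + t \<cdot>\<^sub>v u + h \<cdot>\<^sub>v u) - f (z + t \<cdot>\<^sub>v u) - J *\<^sub>v (h \<cdot>\<^sub>v u)) \<le> e * vnorm (h \<cdot>\<^sub>v u)"
      using u by (intro \<delta>(2)) auto
    moreover have "\<bar>(f (z + t \<cdot>\<^sub>v u + h \<cdot>\<^sub>v u) - f (z + t \<cdot>\<^sub>v u) - J *\<^sub>v (h \<cdot>\<^sub>v u)) $ p\<bar>
        \<le> vnorm (f (z + t \<cdot>\<^sub>v u + h \<cdot>\<^sub>v u) - f (z + t \<cdot>\<^sub>v u) - J *\<^sub>v (h \<cdot>\<^sub>v u))"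
      using f J z u p by (intro abs_index_le_vnorm) auto
    moreover have "(f (z + t \<cdot>\<^sub>v u + h \<cdot>\<^sub>v u) - f (z + t \<cdot>\<^sub>v u) - J *\<^sub>v (h \<cdot>\<^sub>v u)) $ p
        = f (z + (t + h) \<cdot>\<^sub>v u) $ p - f (z + t \<cdot>\<^sub>v u) $ p - h * (J *\<^sub>v u) $ p"
      using f J z u p mult_mat_vec[OF J u, of h] eq
      by (auto simp: carrier_vecD[OF f])
    ultimately have "\<bar>f (z + (t + h) \<cdot>\<^sub>v u) $ p - f (z + t \<cdot>\<^sub>v u) $ p - h * (J *\<^sub>v u) $ p\<bar>
        \<le> \<bar>h\<bar> * (e * vnorm u)"
      by (simp add: vnorm_smult algebra_simps)
    also have "\<dots> < \<bar>h\<bar> * r"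
      using h e(2) by simp
    finally have "\<bar>(f (z + (t + h) \<cdot>\<^sub>v u) $ p - f (z + t \<cdot>\<^sub>v u) $ p - h * (J *\<^sub>v u) $ p) / h\<bar> < r"
      using h by (simp add: abs_divide field_simps)
    then show "norm ((f (z + (t + h) \<cdot>\<^sub>v u) $ p - f (z + t \<cdot>\<^sub>v u) $ p) / h - (J *\<^sub>v u) $ p) < r"
      using h by (simp add: diff_divide_distrib)
  qed
qed

lemma finite_diff_carrier:
  assumes "C1_map m n f f'" "z \<in> carrier_vec m" "u \<in> carrier_vec m"
  shows "finite_diff \<tau> f z u \<in> carrier_vec n"
  using C1_mapD(1)[OF assms(1)] assms(2,3) by (simp add: finite_diff_def)

lemma index_finite_diff:
  assumes "C1_map m n f f'" "z \<in> carrier_vec m" "u \<in> carrier_vec m" "p < n"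
  shows "finite_diff \<tau> f z u $ p = (f (z + \<tau> \<cdot>\<^sub>v u) $ p - f z $ p) / \<tau>"
  using C1_mapD(1)[OF assms(1)] assms(2-4)
  by (auto simp: finite_diff_def carrier_vecD[OF C1_mapD(1)[OF assms(1)]])

text \<open>The mean value theorem is a statement about scalar functions, so it is applied to
  component \<open>p\<close> along the segment from \<open>z\<close>. The intermediate point
  \<open>s\<close> differs from component to component.\<close>

lemma finite_diff_mean_value:
  assumes C1: "C1_map m n f f'" and z: "z \<in> carrier_vec m" and u: "u \<in> carrier_vec m"
    and p: "p < n" and \<tau>: "\<tau> > 0"
  shows "\<exists>s. 0 < s \<and> s < \<tau> \<and> finite_diff \<tau> f z u $ p = (f' (z + s \<cdot>\<^sub>v u) *\<^sub>v u) $ p"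
proof -
  have der: "((\<lambda>t. f (z + t \<cdot>\<^sub>v u) $ p) has_real_derivative (f' (z + t \<cdot>\<^sub>v u) *\<^sub>v u) $ p) (at t)" for t
    using C1_mapD[OF C1] z u p by (intro has_jacobian_at_line) auto
  have "z + 0 \<cdot>\<^sub>v u = z"
    using z u by (intro eq_vecI) auto
  then have "\<exists>s. 0 < s \<and> s < \<tau> \<and> f (z + \<tau> \<cdot>\<^sub>v u) $ p - f z $ p = (\<tau> - 0) * (f' (z + s \<cdot>\<^sub>v u) *\<^sub>v u) $ p"
    using MVT2[OF \<tau>, of "\<lambda>t. f (z + t \<cdot>\<^sub>v u) $ p", OF der] by simp
  with \<tau> show ?thesis
    by (auto simp: index_finite_diff[OF C1 z u p] simp del: index_mult_mat_vec)
qed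

text \<open>The base point moves with \<open>\<tau>\<close>, so differentiability at the limit point would not suffice;
  the mean value theorem turns the difference quotient into a value of the continuous Jacobian.\<close>

lemma finite_diff_tendsto:
  assumes C1: "C1_map m n f f'" and p: "p < n"
    and zc: "\<And>\<tau>. \<tau> > 0 \<Longrightarrow> z \<tau> \<in> carrier_vec m" and uc: "\<And>\<tau>. \<tau> > 0 \<Longrightarrow> u \<tau> \<in> carrier_vec m"
    and Z: "Z \<in> carrier_vec m" and U: "U \<in> carrier_vec m"
    and zl: "\<And>q. q < m \<Longrightarrow> ((\<lambda>\<tau>. z \<tau> $ q) \<longlongrightarrow> Z $ q) (at_right 0)"
    and ul: "\<And>q. q < m \<Longrightarrow> ((\<lambda>\<tau>. u \<tau> $ q) \<longlongrightarrow> U $ q) (at_right 0)"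
  shows "((\<lambda>\<tau>. finite_diff \<tau> f (z \<tau>) (u \<tau>) $ p) \<longlongrightarrow> (f' Z *\<^sub>v U) $ p) (at_right 0)"
proof -
  \<comment> \<open>The intermediate points are collected into a function of \<tau> by choice. The
    bounds \<open>0 < s \<tau> < \<tau>\<close> force it to 0, so the shifted base points have the
    same limit as \<open>z \<tau>\<close>.\<close>
  have "\<exists>s. \<forall>\<tau>. \<tau> > 0 \<longrightarrow> 0 < s \<tau> \<and> s \<tau> < \<tau> \<and>
      finite_diff \<tau> f (z \<tau>) (u \<tau>) $ p = (f' (z \<tau> + s \<tau> \<cdot>\<^sub>v u \<tau>) *\<^sub>v u \<tau>) $ p"
    using finite_diff_mean_value[OF C1 zc uc p] by (intro choice allI) blast
  then obtain s where s: "\<And>\<tau>. \<tau> > 0 \<Longrightarrow> 0 < s \<tau> \<and> s \<tau> < \<tau> \<and>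
      finite_diff \<tau> f (z \<tau>) (u \<tau>) $ p = (f' (z \<tau> + s \<tau> \<cdot>\<^sub>v u \<tau>) *\<^sub>v u \<tau>) $ p"
    by blast
  have pos: "\<forall>\<^sub>F \<tau> in at_right (0 :: real). \<tau> > 0"
    by (rule eventually_at_right_less)
  have s0: "(s \<longlongrightarrow> 0) (at_right 0)"
  proof (rule tendsto_sandwich[of "\<lambda>_. 0" _ _ "\<lambda>\<tau>. \<tau>"])
    show "\<forall>\<^sub>F \<tau> in at_right 0. 0 \<le> s \<tau>" "\<forall>\<^sub>F \<tau> in at_right 0. s \<tau> \<le> \<tau>"
      using pos by (eventually_elim, use s in fastforce)+
  qed (auto intro: tendsto_eq_intros)
  have w: "((\<lambda>\<tau>. (z \<tau> + s \<tau> \<cdot>\<^sub>v u \<tau>) $ q) \<longlongrightarrow> Z $ q) (at_right 0)" if q: "q < m" for q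
  proof (rule Lim_transform_eventually)
    show "((\<lambda>\<tau>. z \<tau> $ q + s \<tau> * u \<tau> $ q) \<longlongrightarrow> Z $ q) (at_right 0)"
      using tendsto_add[OF zl[OF q] tendsto_mult[OF s0 ul[OF q]]] by simp
    show "\<forall>\<^sub>F \<tau> in at_right 0. z \<tau> $ q + s \<tau> * u \<tau> $ q = (z \<tau> + s \<tau> \<cdot>\<^sub>v u \<tau>) $ q"
      using pos by eventually_elim (use uc q in fastforce)
  qed
  have wc: "\<forall>\<^sub>F \<tau> in at_right 0. z \<tau> + s \<tau> \<cdot>\<^sub>v u \<tau> \<in> carrier_vec m"
    using pos by eventually_elim (use uc zc in auto)
  show ?thesis
  proof (rule Lim_transform_eventually)
    have "((\<lambda>\<tau>. f' (z \<tau> + s \<tau> \<cdot>\<^sub>v u \<tau>) $$ (p, q)) \<longlongrightarrow> f' Z $$ (p, q)) (at_right 0)" if "q < m" for q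
      using w wc Z that by (intro vcontinuous_tendsto[OF C1_map_jacobian_continuous[OF C1 p]])
    then have "((\<lambda>\<tau>. \<Sum>q<m. f' (z \<tau> + s \<tau> \<cdot>\<^sub>v u \<tau>) $$ (p, q) * u \<tau> $ q) \<longlongrightarrow>
        (\<Sum>q<m. f' Z $$ (p, q) * U $ q)) (at_right 0)"
      by (intro tendsto_intros) (auto intro: ul)
    then show "((\<lambda>\<tau>. \<Sum>q<m. f' (z \<tau> + s \<tau> \<cdot>\<^sub>v u \<tau>) $$ (p, q) * u \<tau> $ q) \<longlongrightarrow>
        (f' Z *\<^sub>v U) $ p) (at_right 0)"
      using index_mult_mat_vec_sum[OF C1_mapD(2)[OF C1 Z] U p] by simp
    show "\<forall>\<^sub>F \<tau> in at_right 0. (\<Sum>q<m. f' (z \<tau> + s \<tau> \<cdot>\<^sub>v u \<tau>) $$ (p, q) * u \<tau> $ q) =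
        finite_diff \<tau> f (z \<tau>) (u \<tau>) $ p"
      using pos
    proof eventually_elim
      case (elim \<tau>)
      then have "z \<tau> + s \<tau> \<cdot>\<^sub>v u \<tau> \<in> carrier_vec m"
        using zc uc by auto
      from index_mult_mat_vec_sum[OF C1_mapD(2)[OF C1 this] uc[OF elim] p] s[OF elim]
      show ?case
        by simp
    qed
  qed
qed

lemma aug_jac_mult:
  assumes "C1_map m n f f'" "z \<in> carrier_vec m" "u \<in> carrier_vec m"
  shows "aug_jac m f' z *\<^sub>v u = (f' z *\<^sub>v u) @\<^sub>v u"
  using C1_mapD(2)[OF assms(1,2)] assms(3)
  by (simp add: aug_jac_def mat_mult_append[OF _ one_carrier_mat])

text \<open>The difference quotient of the identity is exact for nonzero \<tau>. The regularization
  block therefore involves no limit, and only the original observation map has to be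
  differentiated.\<close>

lemma finite_diff_aug_obs:
  assumes "C1_map m n f f'" "z \<in> carrier_vec m" "u \<in> carrier_vec m" "\<tau> > 0"
  shows "finite_diff \<tau> (aug_obs f) z u = finite_diff \<tau> f z u @\<^sub>v u"
proof -
  have "f z \<in> carrier_vec n" "f (z + \<tau> \<cdot>\<^sub>v u) \<in> carrier_vec n"
    using C1_mapD(1)[OF assms(1)] assms(2,3) by auto
  then show ?thesis
    using assms(2-4) by (intro eq_vecI) (auto simp: finite_diff_def aug_obs_def)
qed

subsection \<open>Pointwise convergence of measurable families\<close>

text \<open>Measurability is carried along with the limit because a non-measurable event has \<open>measure\<close> 0.\<close>

definition conv_real :: "'w measure \<Rightarrow> (real \<Rightarrow> 'w \<Rightarrow> real) \<Rightarrow> ('w \<Rightarrow> real) \<Rightarrow> bool" where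
  "conv_real P x y \<longleftrightarrow> (\<forall>\<tau>>0. x \<tau> \<in> borel_measurable P) \<and> y \<in> borel_measurable P \<and>
     (\<forall>\<omega>\<in>space P. ((\<lambda>\<tau>. x \<tau> \<omega>) \<longlongrightarrow> y \<omega>) (at_right 0))"

text \<open>The family is constrained only for \<tau> > 0. At \<tau> = 0 the difference quotient
  degenerates to 0 by the convention \<open>1 / 0 = 0\<close>, so formulas such as the one for the
  augmented observations fail there.\<close>

definition conv_vec :: "'w measure \<Rightarrow> nat \<Rightarrow> (real \<Rightarrow> 'w \<Rightarrow> real vec) \<Rightarrow> ('w \<Rightarrow> real vec) \<Rightarrow> bool" where
  "conv_vec P n X Y \<longleftrightarrow>
     (\<forall>\<omega>\<in>space P. Y \<omega> \<in> carrier_vec n \<and> (\<forall>\<tau>>0. X \<tau> \<omega> \<in> carrier_vec n)) \<and>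
     (\<forall>p<n. conv_real P (\<lambda>\<tau> \<omega>. X \<tau> \<omega> $ p) (\<lambda>\<omega>. Y \<omega> $ p))"

definition conv_mat ::
  "'w measure \<Rightarrow> nat \<Rightarrow> nat \<Rightarrow> (real \<Rightarrow> 'w \<Rightarrow> real mat) \<Rightarrow> ('w \<Rightarrow> real mat) \<Rightarrow> bool" where
  "conv_mat P r c A B \<longleftrightarrow>
     (\<forall>\<omega>\<in>space P. B \<omega> \<in> carrier_mat r c \<and> (\<forall>\<tau>>0. A \<tau> \<omega> \<in> carrier_mat r c)) \<and>
     (\<forall>p<r. \<forall>q<c. conv_real P (\<lambda>\<tau> \<omega>. A \<tau> \<omega> $$ (p, q)) (\<lambda>\<omega>. B \<omega> $$ (p, q)))"

text \<open>Entry formulas for sums, products and inverses hold only when the dimensions are right,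
  hence only for \<tau> > 0 and outcomes in \<open>space P\<close>. This lemma makes such
  conditional equations usable: a limit at 0 from the right sees only \<tau> > 0, and measurability
  sees only points of the space.\<close>

lemma conv_real_cong:
  assumes "conv_real P x y"
    and x: "\<And>\<tau> \<omega>. \<tau> > 0 \<Longrightarrow> \<omega> \<in> space P \<Longrightarrow> x' \<tau> \<omega> = x \<tau> \<omega>"
    and y: "\<And>\<omega>. \<omega> \<in> space P \<Longrightarrow> y' \<omega> = y \<omega>"
  shows "conv_real P x' y'"
  unfolding conv_real_def
proof (intro conjI allI impI ballI)
  fix \<tau> :: real assume \<tau>: "\<tau> > 0"
  have "x' \<tau> \<in> borel_measurable P \<longleftrightarrow> x \<tau> \<in> borel_measurable P"
    using x[OF \<tau>] by (intro measurable_cong)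
  with assms(1) \<tau> show "x' \<tau> \<in> borel_measurable P"
    by (simp add: conv_real_def)
next
  have "y' \<in> borel_measurable P \<longleftrightarrow> y \<in> borel_measurable P"
    using y by (intro measurable_cong)
  with assms(1) show "y' \<in> borel_measurable P"
    by (simp add: conv_real_def)
next
  fix \<omega> assume \<omega>: "\<omega> \<in> space P"
  have "\<forall>\<^sub>F \<tau> in at_right 0. x \<tau> \<omega> = x' \<tau> \<omega>"
    using eventually_at_right_less[of "0 :: real"] by eventually_elim (simp add: x \<omega>)
  with assms(1) \<omega> show "((\<lambda>\<tau>. x' \<tau> \<omega>) \<longlongrightarrow> y' \<omega>) (at_right 0)"
    unfolding y[OF \<omega>] by (auto simp: conv_real_def intro: Lim_transform_eventually)
qed

section \<open>Arithmetic of converging scalar families\<close>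

lemma conv_real_const: "y \<in> borel_measurable P \<Longrightarrow> conv_real P (\<lambda>_. y) y"
  by (simp add: conv_real_def)

lemma conv_real_add:
  "conv_real P x y \<Longrightarrow> conv_real P x' y' \<Longrightarrow> conv_real P (\<lambda>\<tau> \<omega>. x \<tau> \<omega> + x' \<tau> \<omega>) (\<lambda>\<omega>. y \<omega> + y' \<omega>)"
  by (auto simp: conv_real_def intro!: tendsto_intros borel_measurable_add)

lemma conv_real_diff:
  "conv_real P x y \<Longrightarrow> conv_real P x' y' \<Longrightarrow> conv_real P (\<lambda>\<tau> \<omega>. x \<tau> \<omega> - x' \<tau> \<omega>) (\<lambda>\<omega>. y \<omega> - y' \<omega>)"
  by (auto simp: conv_real_def intro!: tendsto_intros borel_measurable_diff)

lemma conv_real_mult: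
  "conv_real P x y \<Longrightarrow> conv_real P x' y' \<Longrightarrow> conv_real P (\<lambda>\<tau> \<omega>. x \<tau> \<omega> * x' \<tau> \<omega>) (\<lambda>\<omega>. y \<omega> * y' \<omega>)"
  by (auto simp: conv_real_def intro!: tendsto_intros borel_measurable_times)

text \<open>Only the limit of the denominator has to be nonzero: a quotient of measurable functions
  is measurable in any case, division by 0 giving 0.\<close>

lemma conv_real_divide:
  "conv_real P x y \<Longrightarrow> conv_real P x' y' \<Longrightarrow> (\<And>\<omega>. \<omega> \<in> space P \<Longrightarrow> y' \<omega> \<noteq> 0) \<Longrightarrow>
    conv_real P (\<lambda>\<tau> \<omega>. x \<tau> \<omega> / x' \<tau> \<omega>) (\<lambda>\<omega>. y \<omega> / y' \<omega>)"
  by (auto simp: conv_real_def intro!: tendsto_intros borel_measurable_divide)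

text \<open>For \<open>c = 0\<close> both sides are constantly 0, so this works as an introduction
  rule without a side condition.\<close>

lemma conv_real_divide_const:
  "conv_real P x y \<Longrightarrow> conv_real P (\<lambda>\<tau> \<omega>. x \<tau> \<omega> / c) (\<lambda>\<omega>. y \<omega> / c)"
  by (cases "c = 0") (auto simp: conv_real_def intro!: tendsto_intros)

lemma conv_real_sum:
  "(\<And>a. a \<in> S \<Longrightarrow> conv_real P (x a) (y a)) \<Longrightarrow>
    conv_real P (\<lambda>\<tau> \<omega>. \<Sum>a\<in>S. x a \<tau> \<omega>) (\<lambda>\<omega>. \<Sum>a\<in>S. y a \<omega>)"
  by (auto simp: conv_real_def intro!: tendsto_intros borel_measurable_sum)

lemma conv_real_prod:
  "(\<And>a. a \<in> S \<Longrightarrow> conv_real P (x a) (y a)) \<Longrightarrow>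
    conv_real P (\<lambda>\<tau> \<omega>. \<Prod>a\<in>S. x a \<tau> \<omega>) (\<lambda>\<omega>. \<Prod>a\<in>S. y a \<omega>)"
  by (auto simp: conv_real_def intro!: tendsto_intros borel_measurable_prod)

lemmas conv_real_intros = conv_real_add conv_real_diff conv_real_mult conv_real_divide_const
  conv_real_sum conv_real_prod

section \<open>Vectors and matrices, entry by entry\<close>

lemma conv_vec_carrier:
  assumes "conv_vec P n X Y" "\<omega> \<in> space P"
  shows "Y \<omega> \<in> carrier_vec n" "\<tau> > 0 \<Longrightarrow> X \<tau> \<omega> \<in> carrier_vec n"
  using assms by (auto simp: conv_vec_def)

lemma conv_vec_dim:
  assumes "conv_vec P n X Y" "\<omega> \<in> space P"
  shows "dim_vec (Y \<omega>) = n" "\<tau> > 0 \<Longrightarrow> dim_vec (X \<tau> \<omega>) = n"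
  using conv_vec_carrier[OF assms] by auto

lemma conv_vec_index:
  "conv_vec P n X Y \<Longrightarrow> p < n \<Longrightarrow> conv_real P (\<lambda>\<tau> \<omega>. X \<tau> \<omega> $ p) (\<lambda>\<omega>. Y \<omega> $ p)"
  by (simp add: conv_vec_def)

lemma conv_mat_carrier:
  assumes "conv_mat P r c A B" "\<omega> \<in> space P"
  shows "B \<omega> \<in> carrier_mat r c" "\<tau> > 0 \<Longrightarrow> A \<tau> \<omega> \<in> carrier_mat r c"
  using assms by (auto simp: conv_mat_def)

lemma conv_mat_dim:
  assumes "conv_mat P r c A B" "\<omega> \<in> space P"
  shows "dim_row (B \<omega>) = r" "dim_col (B \<omega>) = c"
    "\<tau> > 0 \<Longrightarrow> dim_row (A \<tau> \<omega>) = r" "\<tau> > 0 \<Longrightarrow> dim_col (A \<tau> \<omega>) = c"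
  using conv_mat_carrier[OF assms] by auto

lemma conv_mat_index:
  "conv_mat P r c A B \<Longrightarrow> p < r \<Longrightarrow> q < c \<Longrightarrow>
    conv_real P (\<lambda>\<tau> \<omega>. A \<tau> \<omega> $$ (p, q)) (\<lambda>\<omega>. B \<omega> $$ (p, q))"
  by (simp add: conv_mat_def)

lemma conv_vec_cong:
  assumes "conv_vec P n X Y"
    and X: "\<And>\<tau> \<omega>. \<tau> > 0 \<Longrightarrow> \<omega> \<in> space P \<Longrightarrow> X' \<tau> \<omega> = X \<tau> \<omega>"
    and Y: "\<And>\<omega>. \<omega> \<in> space P \<Longrightarrow> Y' \<omega> = Y \<omega>"
  shows "conv_vec P n X' Y'"
  unfolding conv_vec_def
proof (intro conjI ballI allI impI)
  fix p assume "p < n"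
  then show "conv_real P (\<lambda>\<tau> \<omega>. X' \<tau> \<omega> $ p) (\<lambda>\<omega>. Y' \<omega> $ p)"
    by (rule conv_real_cong[OF conv_vec_index[OF assms(1)]]) (simp_all add: X Y)
qed (simp_all add: X Y conv_vec_carrier[OF assms(1)])

lemma conv_vec_build:
  assumes "\<And>p. p < n \<Longrightarrow> conv_real P (\<lambda>\<tau> \<omega>. x \<tau> \<omega> p) (\<lambda>\<omega>. y \<omega> p)"
  shows "conv_vec P n (\<lambda>\<tau> \<omega>. Matrix.vec n (x \<tau> \<omega>)) (\<lambda>\<omega>. Matrix.vec n (y \<omega>))"
  using assms by (auto simp: conv_vec_def)

lemma conv_mat_build:
  assumes "\<And>p q. p < r \<Longrightarrow> q < c \<Longrightarrow> conv_real P (\<lambda>\<tau> \<omega>. a \<tau> \<omega> (p, q)) (\<lambda>\<omega>. b \<omega> (p, q))"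
  shows "conv_mat P r c (\<lambda>\<tau> \<omega>. Matrix.mat r c (a \<tau> \<omega>)) (\<lambda>\<omega>. Matrix.mat r c (b \<omega>))"
  using assms by (auto simp: conv_mat_def)

lemma conv_vec_const: "v \<in> carrier_vec n \<Longrightarrow> conv_vec P n (\<lambda>_ _. v) (\<lambda>_. v)"
  by (simp add: conv_vec_def conv_real_const)

lemma conv_mat_const: "A \<in> carrier_mat r c \<Longrightarrow> conv_mat P r c (\<lambda>_ _. A) (\<lambda>_. A)"
  by (simp add: conv_mat_def conv_real_const)

lemma conv_vec_add:
  assumes "conv_vec P n X Y" "conv_vec P n X' Y'"
  shows "conv_vec P n (\<lambda>\<tau> \<omega>. X \<tau> \<omega> + X' \<tau> \<omega>) (\<lambda>\<omega>. Y \<omega> + Y' \<omega>)"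
  unfolding conv_vec_def
proof (intro conjI ballI allI impI)
  fix p assume p: "p < n"
  from conv_real_add[OF conv_vec_index[OF assms(1) p] conv_vec_index[OF assms(2) p]]
  show "conv_real P (\<lambda>\<tau> \<omega>. (X \<tau> \<omega> + X' \<tau> \<omega>) $ p) (\<lambda>\<omega>. (Y \<omega> + Y' \<omega>) $ p)"
    by (rule conv_real_cong) (simp_all add: assms[THEN conv_vec_dim(1)] assms[THEN conv_vec_dim(2)] p)
qed (auto simp: assms[THEN conv_vec_carrier(1)] assms[THEN conv_vec_carrier(2)])

lemma conv_vec_diff:
  assumes "conv_vec P n X Y" "conv_vec P n X' Y'"
  shows "conv_vec P n (\<lambda>\<tau> \<omega>. X \<tau> \<omega> - X' \<tau> \<omega>) (\<lambda>\<omega>. Y \<omega> - Y' \<omega>)"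
  unfolding conv_vec_def
proof (intro conjI ballI allI impI)
  fix p assume p: "p < n"
  from conv_real_diff[OF conv_vec_index[OF assms(1) p] conv_vec_index[OF assms(2) p]]
  show "conv_real P (\<lambda>\<tau> \<omega>. (X \<tau> \<omega> - X' \<tau> \<omega>) $ p) (\<lambda>\<omega>. (Y \<omega> - Y' \<omega>) $ p)"
    by (rule conv_real_cong) (simp_all add: assms[THEN conv_vec_dim(1)] assms[THEN conv_vec_dim(2)] p)
qed (auto simp: assms[THEN conv_vec_carrier(1)] assms[THEN conv_vec_carrier(2)])

lemma conv_vec_append:
  assumes "conv_vec P n X Y" "conv_vec P n' X' Y'"
  shows "conv_vec P (n + n') (\<lambda>\<tau> \<omega>. X \<tau> \<omega> @\<^sub>v X' \<tau> \<omega>) (\<lambda>\<omega>. Y \<omega> @\<^sub>v Y' \<omega>)"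
  unfolding conv_vec_def
proof (intro conjI ballI allI impI)
  fix p assume p: "p < n + n'"
  have "conv_real P (\<lambda>\<tau> \<omega>. if p < n then X \<tau> \<omega> $ p else X' \<tau> \<omega> $ (p - n))
      (\<lambda>\<omega>. if p < n then Y \<omega> $ p else Y' \<omega> $ (p - n))"
    using p conv_vec_index[OF assms(1), of p] conv_vec_index[OF assms(2), of "p - n"]
    by (cases "p < n") auto
  then show "conv_real P (\<lambda>\<tau> \<omega>. (X \<tau> \<omega> @\<^sub>v X' \<tau> \<omega>) $ p) (\<lambda>\<omega>. (Y \<omega> @\<^sub>v Y' \<omega>) $ p)"
    by (rule conv_real_cong)
      (simp_all add: assms[THEN conv_vec_dim(1)] assms[THEN conv_vec_dim(2)] p)
qed (auto simp: assms[THEN conv_vec_carrier(1)] assms[THEN conv_vec_carrier(2)])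

lemma conv_vec_block:
  assumes "conv_vec P r X Y" "(i + 1) * m \<le> r"
  shows "conv_vec P m (\<lambda>\<tau> \<omega>. block m i (X \<tau> \<omega>)) (\<lambda>\<omega>. block m i (Y \<omega>))"
  unfolding block_def using assms(2)
  by (intro conv_vec_build conv_vec_index[OF assms(1)]) simp

lemma conv_vec_sample_mean:
  assumes "\<And>n. n \<in> {1..N} \<Longrightarrow> conv_vec P r (\<lambda>\<tau> \<omega>. X \<tau> \<omega> n) (\<lambda>\<omega>. Y \<omega> n)"
  shows "conv_vec P r (\<lambda>\<tau> \<omega>. sample_mean r N (X \<tau> \<omega>)) (\<lambda>\<omega>. sample_mean r N (Y \<omega>))"
  unfolding sample_mean_def
  by (intro conv_vec_build conv_real_intros conv_vec_index[OF assms])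

lemma conv_mat_sample_outer:
  assumes "\<And>n. n \<in> {1..N} \<Longrightarrow> conv_vec P r (\<lambda>\<tau> \<omega>. U \<tau> \<omega> n) (\<lambda>\<omega>. U' \<omega> n)"
    and "\<And>n. n \<in> {1..N} \<Longrightarrow> conv_vec P c (\<lambda>\<tau> \<omega>. T \<tau> \<omega> n) (\<lambda>\<omega>. T' \<omega> n)"
  shows "conv_mat P r c (\<lambda>\<tau> \<omega>. sample_outer r c N (U \<tau> \<omega>) (T \<tau> \<omega>))
    (\<lambda>\<omega>. sample_outer r c N (U' \<omega>) (T' \<omega>))"
  unfolding sample_outer_def
  by (intro conv_mat_build)
    (auto intro!: conv_real_intros conv_vec_index[OF assms(1)] conv_vec_index[OF assms(2)])

lemma conv_mat_add:
  assumes "conv_mat P r c A B" "conv_mat P r c A' B'"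
  shows "conv_mat P r c (\<lambda>\<tau> \<omega>. A \<tau> \<omega> + A' \<tau> \<omega>) (\<lambda>\<omega>. B \<omega> + B' \<omega>)"
  unfolding conv_mat_def
proof (intro conjI ballI allI impI)
  fix p q assume pq: "p < r" "q < c"
  from conv_real_add[OF conv_mat_index[OF assms(1) pq] conv_mat_index[OF assms(2) pq]]
  show "conv_real P (\<lambda>\<tau> \<omega>. (A \<tau> \<omega> + A' \<tau> \<omega>) $$ (p, q)) (\<lambda>\<omega>. (B \<omega> + B' \<omega>) $$ (p, q))"
    by (rule conv_real_cong)
      (simp_all add: assms[THEN conv_mat_dim(1)] assms[THEN conv_mat_dim(2)]
        assms[THEN conv_mat_dim(3)] assms[THEN conv_mat_dim(4)] pq)
qed (auto simp: assms[THEN conv_mat_carrier(1)] assms[THEN conv_mat_carrier(2)])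

lemma conv_mat_mult_vec:
  assumes A: "conv_mat P r c A B" and X: "conv_vec P c X Y"
  shows "conv_vec P r (\<lambda>\<tau> \<omega>. A \<tau> \<omega> *\<^sub>v X \<tau> \<omega>) (\<lambda>\<omega>. B \<omega> *\<^sub>v Y \<omega>)"
  unfolding conv_vec_def
proof (intro conjI ballI allI impI)
  fix p assume p: "p < r"
  then have "conv_real P (\<lambda>\<tau> \<omega>. \<Sum>q<c. A \<tau> \<omega> $$ (p, q) * X \<tau> \<omega> $ q)
      (\<lambda>\<omega>. \<Sum>q<c. B \<omega> $$ (p, q) * Y \<omega> $ q)"
    by (intro conv_real_intros conv_mat_index[OF A] conv_vec_index[OF X]) auto
  then show "conv_real P (\<lambda>\<tau> \<omega>. (A \<tau> \<omega> *\<^sub>v X \<tau> \<omega>) $ p) (\<lambda>\<omega>. (B \<omega> *\<^sub>v Y \<omega>) $ p)"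
    by (rule conv_real_cong)
      (simp_all only: index_mult_mat_vec_sum[OF conv_mat_carrier(1)[OF A] conv_vec_carrier(1)[OF X] p]
        index_mult_mat_vec_sum[OF conv_mat_carrier(2)[OF A] conv_vec_carrier(2)[OF X] p])
qed (auto intro!: mult_mat_vec_carrier[OF conv_mat_carrier(1)[OF A] conv_vec_carrier(1)[OF X]]
    mult_mat_vec_carrier[OF conv_mat_carrier(2)[OF A] conv_vec_carrier(2)[OF X]])

section \<open>Determinants and inverses\<close>

lemma conv_real_det:
  assumes A: "conv_mat P n n A B"
  shows "conv_real P (\<lambda>\<tau> \<omega>. det (A \<tau> \<omega>)) (\<lambda>\<omega>. det (B \<omega>))"
proof -
  \<comment> \<open>The Leibniz formula exhibits the determinant as a polynomial in the entries, so
    closure under sums and products gives the limit and measurability at once. That \<open>p\<close>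
    permutes the index range keeps the column index \<open>p i\<close> below
    \<open>n\<close>.\<close>
  have "conv_real P (\<lambda>\<tau> \<omega>. \<Sum>p | p permutes {0..<n}. signof p * (\<Prod>i = 0..<n. A \<tau> \<omega> $$ (i, p i)))
      (\<lambda>\<omega>. \<Sum>p | p permutes {0..<n}. signof p * (\<Prod>i = 0..<n. B \<omega> $$ (i, p i)))"
    using permutes_in_image
    by (intro conv_real_sum conv_real_mult conv_real_const conv_real_prod conv_mat_index[OF A])
      fastforce+
  then show ?thesis
    by (rule conv_real_cong)
      (simp_all only: det_def'[OF conv_mat_carrier(1)[OF A]] det_def'[OF conv_mat_carrier(2)[OF A]])
qed

lemma conv_mat_delete:
  assumes A: "conv_mat P r c A B" and i: "i < r" and j: "j < c"
  shows "conv_mat P (r - 1) (c - 1) (\<lambda>\<tau> \<omega>. mat_delete (A \<tau> \<omega>) i j) (\<lambda>\<omega>. mat_delete (B \<omega>) i j)"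
  unfolding conv_mat_def
proof (intro conjI ballI allI impI)
  fix p q assume pq: "p < r - 1" "q < c - 1"
  show "conv_real P (\<lambda>\<tau> \<omega>. mat_delete (A \<tau> \<omega>) i j $$ (p, q)) (\<lambda>\<omega>. mat_delete (B \<omega>) i j $$ (p, q))"
  proof (rule conv_real_cong)
    show "conv_real P
        (\<lambda>\<tau> \<omega>. A \<tau> \<omega> $$ (if p < i then p else Suc p, if q < j then q else Suc q))
        (\<lambda>\<omega>. B \<omega> $$ (if p < i then p else Suc p, if q < j then q else Suc q))"
      using pq i j by (intro conv_mat_index[OF A]) auto
  qed (use pq in \<open>simp_all add: mat_delete_def conv_mat_dim[OF A]\<close>)
qed (auto simp: mat_delete_def conv_mat_dim[OF A])

text \<open>\<open>mat_inverse\<close> runs Gauss-Jordan elimination, whose case distinctions on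
  vanishing pivots hide any continuity in the entries. Uniqueness of the inverse identifies its
  result with the adjugate formula, a quotient of polynomials.\<close>

lemma the_mat_inverse:
  fixes A :: "'a :: field mat"
  assumes A: "A \<in> carrier_mat n n" and det: "det A \<noteq> 0"
  shows "the (mat_inverse A) = inverse (det A) \<cdot>\<^sub>m adj_mat A"
proof -
  have "mat_inverse A \<noteq> None"
    using mat_inverse(1)[OF A, where b = "()"] det_non_zero_imp_unit[OF A det, of "()"] by blast
  then obtain B where B: "mat_inverse A = Some B"
    by blast
  note inv = mat_inverse(2)[OF A B]
  let ?C = "inverse (det A) \<cdot>\<^sub>m adj_mat A"
  have C: "?C \<in> carrier_mat n n" "A * ?C = 1\<^sub>m n"
    using adj_mat[OF A] det by (auto simp: mult_smult_distrib[OF A])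
  have "B = B * (A * ?C)"
    using inv C right_mult_one_mat[of B n n] by auto
  also have "\<dots> = (B * A) * ?C"
    using inv C(1) A by (intro assoc_mult_mat[symmetric, of B n n A n ?C n]) auto
  also have "\<dots> = ?C"
    using inv C left_mult_one_mat[OF C(1)] by auto
  finally show ?thesis
    using B by simp
qed

text \<open>A nonzero limit determinant makes \<open>det (A \<tau> \<omega>)\<close> nonzero only
  below a threshold depending on \<omega>, whereas \<open>conv_mat\<close> asks for dimensions and
  measurability at every \<tau> > 0; hence the separate condition \<open>detA\<close>. The indices
  \<open>q p\<close> of the deleted row and column are swapped because the adjugate is the
  transposed cofactor matrix.\<close>

lemma conv_mat_inverse:
  assumes A: "conv_mat P n n A B"
    and detA: "\<And>\<tau> \<omega>. \<tau> > 0 \<Longrightarrow> \<omega> \<in> space P \<Longrightarrow> det (A \<tau> \<omega>) \<noteq> 0"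
    and detB: "\<And>\<omega>. \<omega> \<in> space P \<Longrightarrow> det (B \<omega>) \<noteq> 0"
  shows "conv_mat P n n (\<lambda>\<tau> \<omega>. the (mat_inverse (A \<tau> \<omega>))) (\<lambda>\<omega>. the (mat_inverse (B \<omega>)))"
proof -
  have inv: "the (mat_inverse M) \<in> carrier_mat n n"
    "\<And>p q. p < n \<Longrightarrow> q < n \<Longrightarrow> the (mat_inverse M) $$ (p, q) =
       (-1) ^ (q + p) * det (mat_delete M q p) / det M"
    if "M \<in> carrier_mat n n" "det M \<noteq> 0" for M :: "real mat"
    using adj_mat(1)[OF that(1)] that(1) unfolding the_mat_inverse[OF that]
    by (auto simp: adj_mat_def cofactor_def field_simps)
  show ?thesis
    unfolding conv_mat_def
  proof (intro conjI ballI allI impI)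
    fix p q assume pq: "p < n" "q < n"
    show "conv_real P (\<lambda>\<tau> \<omega>. the (mat_inverse (A \<tau> \<omega>)) $$ (p, q))
        (\<lambda>\<omega>. the (mat_inverse (B \<omega>)) $$ (p, q))"
    proof (rule conv_real_cong)
      show "conv_real P (\<lambda>\<tau> \<omega>. (-1) ^ (q + p) * det (mat_delete (A \<tau> \<omega>) q p) / det (A \<tau> \<omega>))
          (\<lambda>\<omega>. (-1) ^ (q + p) * det (mat_delete (B \<omega>) q p) / det (B \<omega>))"
        using pq detB
        by (intro conv_real_divide conv_real_mult conv_real_const conv_real_det[OF A]
            conv_real_det[OF conv_mat_delete[OF A]]) auto
    qed (simp_all add: inv pq conv_mat_carrier[OF A] detA detB)
  qed (simp_all add: inv conv_mat_carrier[OF A] detA detB)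
qed

section \<open>Composition with continuously differentiable maps and difference quotients\<close>

lemma conv_real_vcontinuous:
  assumes f: "vcontinuous m f" and X: "conv_vec P m X Y"
  shows "conv_real P (\<lambda>\<tau> \<omega>. f (X \<tau> \<omega>)) (\<lambda>\<omega>. f (Y \<omega>))"
  unfolding conv_real_def
proof (intro conjI allI impI ballI)
  fix \<tau> :: real assume "\<tau> > 0"
  then show "(\<lambda>\<omega>. f (X \<tau> \<omega>)) \<in> borel_measurable P"
    using conv_vec_carrier(2)[OF X] conv_vec_index[OF X]
    by (intro vcontinuous_measurable[OF f]) (auto simp: conv_real_def)
next
  show "(\<lambda>\<omega>. f (Y \<omega>)) \<in> borel_measurable P"
    using conv_vec_carrier(1)[OF X] conv_vec_index[OF X]
    by (intro vcontinuous_measurable[OF f]) (auto simp: conv_real_def)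
next
  fix \<omega> assume \<omega>: "\<omega> \<in> space P"
  have "\<forall>\<^sub>F \<tau> in at_right 0. X \<tau> \<omega> \<in> carrier_vec m"
    using eventually_at_right_less[of "0 :: real"]
    by eventually_elim (rule conv_vec_carrier(2)[OF X \<omega>])
  then show "((\<lambda>\<tau>. f (X \<tau> \<omega>)) \<longlongrightarrow> f (Y \<omega>)) (at_right 0)"
    using conv_vec_carrier(1)[OF X \<omega>] conv_vec_index[OF X] \<omega>
    by (intro vcontinuous_tendsto[OF f]) (auto simp: conv_real_def)
qed

lemma conv_vec_C1_map:
  assumes C1: "C1_map m n f f'" and X: "conv_vec P m X Y"
  shows "conv_vec P n (\<lambda>\<tau> \<omega>. f (X \<tau> \<omega>)) (\<lambda>\<omega>. f (Y \<omega>))"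
  unfolding conv_vec_def
  using conv_real_vcontinuous[OF C1_map_continuous[OF C1] X] C1_mapD(1)[OF C1]
    conv_vec_carrier[OF X] by auto

lemma conv_mat_jacobian:
  assumes C1: "C1_map m n f f'" and X: "conv_vec P m X Y"
  shows "conv_mat P n m (\<lambda>\<tau> \<omega>. f' (X \<tau> \<omega>)) (\<lambda>\<omega>. f' (Y \<omega>))"
  unfolding conv_mat_def
  using conv_real_vcontinuous[OF C1_map_jacobian_continuous[OF C1] X] C1_mapD(2)[OF C1]
    conv_vec_carrier[OF X] by auto

text \<open>The limit is taken for each fixed \<omega> by \<open>finite_diff_tendsto\<close>.
  Measurability is read off the quotient itself, as a composition of continuous components with
  measurable arguments: the intermediate point of the mean value theorem is chosen for each outcome
  separately and may fail to be measurable.\<close>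

lemma conv_vec_finite_diff:
  assumes C1: "C1_map m n f f'" and Z: "conv_vec P m z Z" and U: "conv_vec P m u U"
  shows "conv_vec P n (\<lambda>\<tau> \<omega>. finite_diff \<tau> f (z \<tau> \<omega>) (u \<tau> \<omega>)) (\<lambda>\<omega>. f' (Z \<omega>) *\<^sub>v U \<omega>)"
proof -
  \<comment> \<open>This is used for its limit side: the exact product has the right dimension and
    measurable entries.\<close>
  note lin = conv_mat_mult_vec[OF conv_mat_jacobian[OF C1 Z] U]
  show ?thesis
    unfolding conv_vec_def
  proof (intro conjI allI impI ballI)
    fix \<omega> assume "\<omega> \<in> space P"
    then show "f' (Z \<omega>) *\<^sub>v U \<omega> \<in> carrier_vec n"
      by (rule conv_vec_carrier(1)[OF lin])
    fix \<tau> :: real assume "\<tau> > 0"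
    with \<open>\<omega> \<in> space P\<close> show "finite_diff \<tau> f (z \<tau> \<omega>) (u \<tau> \<omega>) \<in> carrier_vec n"
      by (intro finite_diff_carrier[OF C1] conv_vec_carrier(2)[OF Z] conv_vec_carrier(2)[OF U])
  next
    fix p assume p: "p < n"
    show "conv_real P (\<lambda>\<tau> \<omega>. finite_diff \<tau> f (z \<tau> \<omega>) (u \<tau> \<omega>) $ p) (\<lambda>\<omega>. (f' (Z \<omega>) *\<^sub>v U \<omega>) $ p)"
      unfolding conv_real_def
    proof (intro conjI allI impI ballI)
      show "(\<lambda>\<omega>. (f' (Z \<omega>) *\<^sub>v U \<omega>) $ p) \<in> borel_measurable P"
        using conv_vec_index[OF lin p] by (simp only: conv_real_def)
      fix \<tau> :: real assume \<tau>: "\<tau> > 0"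
      have zu: "z \<tau> \<omega> \<in> carrier_vec m" "u \<tau> \<omega> \<in> carrier_vec m" if "\<omega> \<in> space P" for \<omega>
        using conv_vec_carrier(2)[OF Z that \<tau>] conv_vec_carrier(2)[OF U that \<tau>] .
      have meas: "(\<lambda>\<omega>. z \<tau> \<omega> $ q) \<in> borel_measurable P" "(\<lambda>\<omega>. u \<tau> \<omega> $ q) \<in> borel_measurable P"
        if "q < m" for q
        using conv_vec_index[OF Z that] conv_vec_index[OF U that] \<tau> by (auto simp: conv_real_def)
      have sum: "(\<lambda>\<omega>. (z \<tau> \<omega> + \<tau> \<cdot>\<^sub>v u \<tau> \<omega>) $ q) \<in> borel_measurable P" if q: "q < m" for q
      proof -
        have "(\<lambda>\<omega>. (z \<tau> \<omega> + \<tau> \<cdot>\<^sub>v u \<tau> \<omega>) $ q) \<in> borel_measurable P \<longleftrightarrow>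
            (\<lambda>\<omega>. z \<tau> \<omega> $ q + \<tau> * u \<tau> \<omega> $ q) \<in> borel_measurable P"
          using zu(2) q by (intro measurable_cong) fastforce
        then show ?thesis
          using meas[OF q] by simp
      qed
      have "(\<lambda>\<omega>. finite_diff \<tau> f (z \<tau> \<omega>) (u \<tau> \<omega>) $ p) \<in> borel_measurable P \<longleftrightarrow>
          (\<lambda>\<omega>. (f (z \<tau> \<omega> + \<tau> \<cdot>\<^sub>v u \<tau> \<omega>) $ p - f (z \<tau> \<omega>) $ p) / \<tau>) \<in> borel_measurable P"
        using zu p by (intro measurable_cong index_finite_diff[OF C1])
      moreover have "(\<lambda>\<omega>. f (z \<tau> \<omega> + \<tau> \<cdot>\<^sub>v u \<tau> \<omega>) $ p) \<in> borel_measurable P"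
        using zu sum by (intro vcontinuous_measurable[OF C1_map_continuous[OF C1 p]]) auto
      moreover have "(\<lambda>\<omega>. f (z \<tau> \<omega>) $ p) \<in> borel_measurable P"
        using zu meas by (intro vcontinuous_measurable[OF C1_map_continuous[OF C1 p]]) auto
      ultimately show "(\<lambda>\<omega>. finite_diff \<tau> f (z \<tau> \<omega>) (u \<tau> \<omega>) $ p) \<in> borel_measurable P"
        by simp
    next
      fix \<omega> assume \<omega>: "\<omega> \<in> space P"
      show "((\<lambda>\<tau>. finite_diff \<tau> f (z \<tau> \<omega>) (u \<tau> \<omega>) $ p) \<longlongrightarrow> (f' (Z \<omega>) *\<^sub>v U \<omega>) $ p) (at_right 0)"
        using conv_vec_index[OF Z] conv_vec_index[OF U] \<omega>
        by (intro finite_diff_tendsto[OF C1 p] conv_vec_carrier[OF Z \<omega>] conv_vec_carrier[OF U \<omega>])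
          (auto simp: conv_real_def)
    qed
  qed
qed

lemma conv_vec_finite_diff_aug_obs:
  assumes C1: "C1_map m n f f'" and Z: "conv_vec P m z Z" and U: "conv_vec P m u U"
  shows "conv_vec P (n + m) (\<lambda>\<tau> \<omega>. finite_diff \<tau> (aug_obs f) (z \<tau> \<omega>) (u \<tau> \<omega>))
    (\<lambda>\<omega>. aug_jac m f' (Z \<omega>) *\<^sub>v U \<omega>)"
proof (rule conv_vec_cong)
  show "conv_vec P (n + m) (\<lambda>\<tau> \<omega>. finite_diff \<tau> f (z \<tau> \<omega>) (u \<tau> \<omega>) @\<^sub>v u \<tau> \<omega>)
      (\<lambda>\<omega>. (f' (Z \<omega>) *\<^sub>v U \<omega>) @\<^sub>v U \<omega>)"
    by (intro conv_vec_append conv_vec_finite_diff[OF C1 Z] U)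
qed (simp_all add: finite_diff_aug_obs[OF C1] aug_jac_mult[OF C1] conv_vec_carrier[OF Z]
    conv_vec_carrier[OF U])

section \<open>From pointwise convergence to convergence in probability\<close>

lemma (in prob_space) conv_vec_imp_tends_in_prob:
  assumes X: "conv_vec M n X Y"
  shows "tends_in_prob_at_0 M X Y"
  unfolding tends_in_prob_at_0_def
proof (intro allI impI)
  fix \<epsilon> \<epsilon>' :: real assume \<epsilon>: "\<epsilon> > 0" "\<epsilon>' > 0"
  let ?D = "\<lambda>\<tau> \<omega>. vnorm (X \<tau> \<omega> - Y \<omega>)"
  have measD: "?D \<tau> \<in> borel_measurable M" if \<tau>: "\<tau> > 0" for \<tau>
  proof -
    have "?D \<tau> \<in> borel_measurable M \<longleftrightarrow>
        (\<lambda>\<omega>. sqrt (\<Sum>p<n. (X \<tau> \<omega> $ p - Y \<omega> $ p)\<^sup>2)) \<in> borel_measurable M"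
      using conv_vec_carrier[OF X] \<tau>
      by (intro measurable_cong)
        (auto simp: vnorm_eq_sum[of _ n] conv_vec_dim[OF X] intro!: sum.cong)
    moreover have "(\<lambda>\<omega>. X \<tau> \<omega> $ p) \<in> borel_measurable M" "(\<lambda>\<omega>. Y \<omega> $ p) \<in> borel_measurable M"
      if "p < n" for p
      using conv_vec_index[OF X that] \<tau> by (auto simp: conv_real_def)
    ultimately show ?thesis
      by (simp add: borel_measurable_sum)
  qed
  have limD: "((\<lambda>\<tau>. ?D \<tau> \<omega>) \<longlongrightarrow> 0) (at_right 0)" if \<omega>: "\<omega> \<in> space M" for \<omega>
  proof (rule tendsto_vnorm_diff)
    show "\<forall>\<^sub>F \<tau> in at_right 0. X \<tau> \<omega> \<in> carrier_vec n"
      using eventually_at_right_less[of "0 :: real"]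
      by eventually_elim (rule conv_vec_carrier(2)[OF X \<omega>])
  qed (use conv_vec_index[OF X] conv_vec_carrier(1)[OF X \<omega>] \<omega> in \<open>auto simp: conv_real_def\<close>)
  define E where "E \<tau> = {\<omega> \<in> space M. ?D \<tau> \<omega> \<le> \<epsilon>}" for \<tau>
  have E: "E \<tau> \<in> sets M" if "\<tau> > 0" for \<tau>
    unfolding E_def using measD[OF that] by measurable
  have "((\<lambda>\<tau>. prob (E \<tau>)) \<longlongrightarrow> 1) (at_right 0)"
  \<comment> \<open>Dominated convergence is a theorem about sequences, so the limit from the right
    is tested along positive step sequences \<open>S\<close> tending to 0. The bound 1 only marks
    out some right neighbourhood of 0.\<close>
  proof (rule tendsto_at_right_sequentially[of 0 1])
    fix S :: "nat \<Rightarrow> real" assume S: "\<And>n. 0 < S n" "S \<longlonglongrightarrow> 0"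
    have S0: "filterlim S (at_right 0) sequentially"
      unfolding filterlim_at using S by (auto simp: less_imp_neq[symmetric])
    have "(\<lambda>k. \<integral>\<omega>. indicat_real (E (S k)) \<omega> \<partial>M) \<longlonglongrightarrow> (\<integral>\<omega>. 1 \<partial>M)"
    proof (rule integral_dominated_convergence[where w = "\<lambda>_. 1"])
      show "AE \<omega> in M. (\<lambda>k. indicat_real (E (S k)) \<omega>) \<longlonglongrightarrow> 1"
      \<comment> \<open>The distance tends to 0 and so drops strictly below
        \<open>\<epsilon>\<close>; from then on \<omega> lies in the event and the indicator equals
        1.\<close>
      proof (rule AE_I2, rule tendsto_eventually)
        fix \<omega> assume \<omega>: "\<omega> \<in> space M"
        have "(\<lambda>k. ?D (S k) \<omega>) \<longlonglongrightarrow> 0"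
          using limD[OF \<omega>] S0 by (rule filterlim_compose)
        then have "\<forall>\<^sub>F k in sequentially. ?D (S k) \<omega> < \<epsilon>"
          using \<epsilon>(1) by (rule order_tendstoD(2))
        then show "\<forall>\<^sub>F k in sequentially. indicat_real (E (S k)) \<omega> = 1"
          by eventually_elim (use \<omega> in \<open>auto simp: E_def indicator_def\<close>)
      qed
    qed (use E[OF S(1)] in \<open>auto simp: indicator_def\<close>)
    then show "(\<lambda>k. prob (E (S k))) \<longlonglongrightarrow> 1"
      using E[OF S(1)] by (simp add: prob_space)
  qed simp
  then have "\<forall>\<^sub>F \<tau> in at_right 0. 1 - \<epsilon>' < prob (E \<tau>)"
    using \<epsilon>(2) by (intro order_tendstoD(1)) auto
  then obtain \<tau>0 where "\<tau>0 > 0" "\<And>\<tau>. 0 < \<tau> \<Longrightarrow> \<tau> < \<tau>0 \<Longrightarrow> 1 - \<epsilon>' < prob (E \<tau>)"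
    by (auto simp: eventually_at_right[of 0 1])
  then show "\<exists>\<tau>0>0. \<forall>\<tau>. 0 < \<tau> \<and> \<tau> < \<tau>0 \<longrightarrow>
      1 - \<epsilon>' \<le> prob {\<omega> \<in> space M. vnorm (X \<tau> \<omega> - Y \<omega>) \<le> \<epsilon>}"
    by (auto simp: E_def intro!: exI[of _ \<tau>0] less_imp_le)
qed

subsection \<open>The innovation covariance\<close>

lemma aug_cov_carrier: "R \<in> carrier_mat r r \<Longrightarrow> aug_cov m r \<gamma> R \<in> carrier_mat (r + m) (r + m)"
  by (simp add: aug_cov_def)

text \<open>The matrix is block diagonal, so with \<open>v\<close> split into \<open>a\<close> and
  \<open>b\<close> the form is that of \<open>R\<close> at \<open>a\<close> plus
  \<open>(b \<bullet> b) / \<gamma>\<close>. If \<open>a\<close> vanishes then \<open>b\<close> does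
  not, and the regularization term alone gives positivity.\<close>

lemma aug_cov_quadratic_form_pos:
  assumes R: "pos_def r R" and \<gamma>: "\<gamma> > 0" and v: "v \<in> carrier_vec (r + m)" "v \<noteq> 0\<^sub>v (r + m)"
  shows "v \<bullet> (aug_cov m r \<gamma> R *\<^sub>v v) > 0"
proof -
  define a b where "a = vec_first v r" and "b = vec_last v m"
  have ab: "a \<in> carrier_vec r" "b \<in> carrier_vec m" "v = a @\<^sub>v b"
    using v(1) by (simp_all add: a_def b_def)
  have Rc: "R \<in> carrier_mat r r"
    using R by (simp add: pos_def_def)
  have "aug_cov m r \<gamma> R *\<^sub>v v = (R *\<^sub>v a + 0\<^sub>m r m *\<^sub>v b) @\<^sub>v
      (0\<^sub>m m r *\<^sub>v a + ((1 / \<gamma>) \<cdot>\<^sub>m 1\<^sub>m m) *\<^sub>v b)"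
    unfolding aug_cov_def ab(3) using Rc ab(1,2) by (intro four_block_mat_mult_vec) auto
  also have "\<dots> = (R *\<^sub>v a) @\<^sub>v ((1 / \<gamma>) \<cdot>\<^sub>v b)"
    using Rc ab(1,2) by (intro arg_cong2[of _ _ _ _ append_vec] eq_vecI) auto
  finally have eq: "v \<bullet> (aug_cov m r \<gamma> R *\<^sub>v v) = a \<bullet> (R *\<^sub>v a) + (b \<bullet> b) / \<gamma>"
    using ab Rc by (simp add: scalar_prod_append[of _ r _ m])
  show ?thesis
  proof (cases "a = 0\<^sub>v r")
    case True
    then have "b \<noteq> 0\<^sub>v m"
      using ab v(2) by auto
    then have "b \<bullet> b > 0"
      using ab(2) conjugate_square_greater_0_vec[of b m] by simp
    then show ?thesis
      using True Rc \<gamma> by (simp add: eq)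
  next
    case False
    then have "a \<bullet> (R *\<^sub>v a) > 0"
      using R ab(1) by (simp add: pos_def_def)
    moreover have "b \<bullet> b \<ge> 0"
      by (simp add: scalar_prod_def sum_nonneg)
    ultimately show ?thesis
      using \<gamma> by (simp add: eq add_pos_nonneg)
  qed
qed

text \<open>The form equals the sum over the members of the squares
  \<open>(\<Sum>p<r. v $ p * h n $ p)\<^sup>2\<close>, divided by \<open>real N - 1\<close>;
  \<open>N \<ge> 1\<close> makes this divisor nonnegative.\<close>

lemma sample_outer_quadratic_form_nonneg:
  assumes v: "v \<in> carrier_vec r" and N: "N \<ge> 1"
  shows "v \<bullet> (sample_outer r r N h h *\<^sub>v v) \<ge> 0"
proof -
  have "v \<bullet> (sample_outer r r N h h *\<^sub>v v) =
      (\<Sum>p<r. \<Sum>q<r. \<Sum>n = 1..N. (v $ p * h n $ p) * (v $ q * h n $ q) / (real N - 1))"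
    using v by (simp add: sample_outer_def scalar_prod_def lessThan_atLeast0 sum_distrib_left
        sum_distrib_right sum_divide_distrib algebra_simps)
  \<comment> \<open>Two exchanges of summation bring the member index outermost; the double sum over
    entries then factors as a square.\<close>
  also have "\<dots> = (\<Sum>p<r. \<Sum>n = 1..N. \<Sum>q<r. (v $ p * h n $ p) * (v $ q * h n $ q) / (real N - 1))"
    by (intro sum.cong refl sum.swap)
  also have "\<dots> = (\<Sum>n = 1..N. \<Sum>p<r. \<Sum>q<r. (v $ p * h n $ p) * (v $ q * h n $ q) / (real N - 1))"
    by (rule sum.swap)
  also have "\<dots> = (\<Sum>n = 1..N. (\<Sum>p<r. v $ p * h n $ p)\<^sup>2 / (real N - 1))"
    by (simp add: power2_eq_square sum_product sum_divide_distrib)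
  also have "\<dots> \<ge> 0"
    using N by (intro sum_nonneg divide_nonneg_nonneg) auto
  finally show ?thesis .
qed

text \<open>A kernel vector would make the two quadratic forms add up to 0. Since \<open>h\<close>
  is arbitrary, the same fact serves exact derivatives, every step \<tau> and every outcome.\<close>

lemma det_innovation_cov_nonzero:
  assumes R: "pos_def r R" and \<gamma>: "\<gamma> > 0" and N: "N \<ge> 1"
  shows "det (sample_outer (r + m) (r + m) N h h + aug_cov m r \<gamma> R) \<noteq> 0"
proof
  let ?D = "sample_outer (r + m) (r + m) N h h" and ?R = "aug_cov m r \<gamma> R"
  have car: "?D \<in> carrier_mat (r + m) (r + m)" "?R \<in> carrier_mat (r + m) (r + m)"
    using R by (auto simp: sample_outer_def pos_def_def intro: aug_cov_carrier)
  assume "det (?D + ?R) = 0"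
  then obtain v where v: "v \<in> carrier_vec (r + m)" "v \<noteq> 0\<^sub>v (r + m)" "(?D + ?R) *\<^sub>v v = 0\<^sub>v (r + m)"
    using det_0_iff_vec_prod_zero_field[of "?D + ?R" "r + m"] car by auto
  have "0 = v \<bullet> ((?D + ?R) *\<^sub>v v)"
    using v by simp
  also have "\<dots> = v \<bullet> (?D *\<^sub>v v) + v \<bullet> (?R *\<^sub>v v)"
    using car v(1) by (simp add: add_mult_distrib_mat_vec scalar_prod_add_distrib[of _ "r + m"])
  also have "\<dots> > 0"
    using sample_outer_quadratic_form_nonneg[OF v(1) N] aug_cov_quadratic_form_pos[OF R \<gamma> v(1,2)]
    by (rule add_nonneg_pos)
  finally show False
    by simp
qed

subsection \<open>The ensemble algorithms\<close>

text \<open>Both runs share the noise, so the family is constant in \<tau> and the content is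
  measurability of the coordinates: their sublevel sets are the generators of
  \<open>vec_borel\<close>.\<close>

lemma gaussian_vec_conv:
  assumes "gaussian_vec P n X \<mu> \<Sigma>"
  shows "conv_vec P n (\<lambda>_. X) X"
proof -
  have gen: "{{v \<in> carrier_vec n. v $ p \<le> c} | p c. p < n} \<subseteq> Pow (carrier_vec n)" for n
    by auto
  have sp: "space (vec_borel n) = carrier_vec n"
    unfolding vec_borel_def using gen by (rule space_measure_of)
  have X: "X \<in> measurable P (vec_borel n)"
    using assms by (simp add: gaussian_vec_def)
  have "(\<lambda>v. v $ p) \<in> borel_measurable (vec_borel n)" if p: "p < n" for p
  proof (rule borel_measurable_iff_le[THEN iffD2], intro allI)
    fix c :: real
    have "{v \<in> carrier_vec n. v $ p \<le> c} \<in> sets (vec_borel n)"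
      unfolding vec_borel_def using gen p by (intro in_measure_of) auto
    then show "{v \<in> space (vec_borel n). v $ p \<le> c} \<in> sets (vec_borel n)"
      by (simp add: sp)
  qed
  then have "(\<lambda>\<omega>. X \<omega> $ p) \<in> borel_measurable P" if "p < n" for p
    using measurable_compose[OF X] that by blast
  moreover have "X \<omega> \<in> carrier_vec n" if "\<omega> \<in> space P" for \<omega>
    using measurable_space[OF X that] by (simp add: sp)
  ultimately show ?thesis
    by (simp add: conv_vec_def conv_real_const)
qed

text \<open>The hypothesis \<open>dM\<close> is continuous convergence: base point and direction may
  both move with \<tau>. The bounds contain \<open>i - 1 + 1\<close> because the forecast reads
  block \<open>i - 1\<close> of both states.\<close>

lemma conv_vec_forecast:
  assumes dM: "\<And>z Z u U. conv_vec P m z Z \<Longrightarrow> conv_vec P m u U \<Longrightarrow>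
      conv_vec P m (\<lambda>\<tau> \<omega>. dM \<tau> i (z \<tau> \<omega>) (u \<tau> \<omega>)) (\<lambda>\<omega>. dM' i (Z \<omega>) (U \<omega>))"
    and model: "C1_map m m (\<M> i) \<M>'" and \<mu>: "\<mu> i \<in> carrier_vec m"
    and z: "conv_vec P r z Z" "(i - 1 + 1) * m \<le> r"
    and x: "conv_vec P s x X" "(i - 1 + 1) * m \<le> s"
    and v: "conv_vec P m v v'"
  shows "conv_vec P m (\<lambda>\<tau> \<omega>. forecast m \<M> \<mu> (dM \<tau>) i (z \<tau> \<omega>) (v \<tau> \<omega>) (x \<tau> \<omega>))
    (\<lambda>\<omega>. forecast m \<M> \<mu> dM' i (Z \<omega>) (v' \<omega>) (X \<omega>))"
  unfolding forecast_def
  by (intro conv_vec_add dM conv_vec_diff conv_vec_C1_map[OF model] conv_vec_const \<mu> v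
      conv_vec_block[OF z] conv_vec_block[OF x])

lemma conv_vec_analysis:
  assumes dH: "\<And>z Z u U. conv_vec P m z Z \<Longrightarrow> conv_vec P m u U \<Longrightarrow>
      conv_vec P (d i + m) (\<lambda>\<tau> \<omega>. dH \<tau> i (z \<tau> \<omega>) (u \<tau> \<omega>)) (\<lambda>\<omega>. dH' i (Z \<omega>) (U \<omega>))"
    and obs: "C1_map m (d i) (\<H> i) \<H>'" and y: "y i \<in> carrier_vec (d i)"
    and R: "pos_def (d i) (R i)" and \<gamma>: "\<gamma> > 0"
    and z: "conv_vec P m z Z"
    and w: "\<And>n. n \<in> {1..N} \<Longrightarrow> conv_vec P (d i + m) (\<lambda>\<tau> \<omega>. w \<tau> \<omega> n) (\<lambda>\<omega>. w' \<omega> n)"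
    and X: "\<And>n. n \<in> {1..N} \<Longrightarrow> conv_vec P ((i + 1) * m) (\<lambda>\<tau> \<omega>. X \<tau> \<omega> n) (\<lambda>\<omega>. X' \<omega> n)"
    and n: "n \<in> {1..N}"
  shows "conv_vec P ((i + 1) * m)
    (\<lambda>\<tau> \<omega>. analysis m d \<H> y R \<gamma> (dH \<tau>) i N (z \<tau> \<omega>) (w \<tau> \<omega>) (X \<tau> \<omega>) n)
    (\<lambda>\<omega>. analysis m d \<H> y R \<gamma> dH' i N (Z \<omega>) (w' \<omega>) (X' \<omega>) n)"
proof -
  have N: "N \<ge> 1"
    using n by simp
  have Rc: "R i \<in> carrier_mat (d i) (d i)"
    using R by (simp add: pos_def_def)
  note F = conv_vec_block[OF X order.refl]
  note h = dH[OF z conv_vec_diff[OF F conv_vec_sample_mean[OF F]]]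
  show ?thesis
    unfolding analysis_def Let_def aug_obs_def
    by (intro conv_vec_add conv_mat_mult_vec[where c = "d i + m"] conv_mat_sample_outer conv_vec_diff
        conv_vec_sample_mean X n h conv_mat_inverse conv_mat_add conv_mat_const aug_cov_carrier Rc
        det_innovation_cov_nonzero[OF R \<gamma> N] conv_vec_append conv_vec_const y z w
        conv_vec_C1_map[OF obs z] dH F)
qed

text \<open>The linearization point \<open>z\<close> depends on \<tau> and is only assumed to
  converge, since in later passes it is a computed mean. The inputs \<open>x\<close>,
  \<open>v\<close>, \<open>w\<close> carry no \<tau>: both algorithms see the same
  perturbations.\<close>

lemma conv_vec_ensemble:
  assumes dM: "\<And>i z Z u U. i \<in> {1..k} \<Longrightarrow> conv_vec P m z Z \<Longrightarrow> conv_vec P m u U \<Longrightarrow>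
      conv_vec P m (\<lambda>\<tau> \<omega>. dM \<tau> i (z \<tau> \<omega>) (u \<tau> \<omega>)) (\<lambda>\<omega>. dM' i (Z \<omega>) (U \<omega>))"
    and dH: "\<And>i z Z u U. i \<in> {1..k} \<Longrightarrow> conv_vec P m z Z \<Longrightarrow> conv_vec P m u U \<Longrightarrow>
      conv_vec P (d i + m) (\<lambda>\<tau> \<omega>. dH \<tau> i (z \<tau> \<omega>) (u \<tau> \<omega>)) (\<lambda>\<omega>. dH' i (Z \<omega>) (U \<omega>))"
    and model: "\<And>i. i \<in> {1..k} \<Longrightarrow> C1_map m m (\<M> i) (\<M>' i)"
    and obs: "\<And>i. i \<in> {1..k} \<Longrightarrow> C1_map m (d i) (\<H> i) (\<H>' i)"
    and vectors: "\<And>i. i \<in> {1..k} \<Longrightarrow> \<mu> i \<in> carrier_vec m"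
      "\<And>i. i \<in> {1..k} \<Longrightarrow> y i \<in> carrier_vec (d i)"
    and R: "\<And>i. i \<in> {1..k} \<Longrightarrow> pos_def (d i) (R i)" and \<gamma>: "\<gamma> > 0"
    and z: "conv_vec P ((k + 1) * m) z Z"
    and x: "\<And>n. n \<in> {1..N} \<Longrightarrow> conv_vec P m (\<lambda>\<tau> \<omega>. x \<omega> n) (\<lambda>\<omega>. x \<omega> n)"
    and v: "\<And>n i. n \<in> {1..N} \<Longrightarrow> i \<in> {1..k} \<Longrightarrow> conv_vec P m (\<lambda>\<tau> \<omega>. v \<omega> n i) (\<lambda>\<omega>. v \<omega> n i)"
    and w: "\<And>n i. n \<in> {1..N} \<Longrightarrow> i \<in> {1..k} \<Longrightarrow>
      conv_vec P (d i + m) (\<lambda>\<tau> \<omega>. w \<omega> n i) (\<lambda>\<omega>. w \<omega> n i)"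
    and i: "i \<le> k" and n: "n \<in> {1..N}"
  shows "conv_vec P ((i + 1) * m)
    (\<lambda>\<tau> \<omega>. ensemble m d \<M> \<H> \<mu> y R \<gamma> (dM \<tau>) (dH \<tau>) N (z \<tau> \<omega>) (x \<omega>) (v \<omega>) (w \<omega>) i n)
    (\<lambda>\<omega>. ensemble m d \<M> \<H> \<mu> y R \<gamma> dM' dH' N (Z \<omega>) (x \<omega>) (v \<omega>) (w \<omega>) i n)"
  using i n
\<comment> \<open>Each analysis step mixes all members through the sample statistics, so the
  induction hypothesis must cover every \<open>n\<close>.\<close>
proof (induction i arbitrary: n)
  case 0
  then show ?case
    using x by simp
next
  case (Suc i)
  then have i: "Suc i \<in> {1..k}" and IH: "\<And>n. n \<in> {1..N} \<Longrightarrow> conv_vec P ((i + 1) * m)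
    (\<lambda>\<tau> \<omega>. ensemble m d \<M> \<H> \<mu> y R \<gamma> (dM \<tau>) (dH \<tau>) N (z \<tau> \<omega>) (x \<omega>) (v \<omega>) (w \<omega>) i n)
    (\<lambda>\<omega>. ensemble m d \<M> \<H> \<mu> y R \<gamma> dM' dH' N (Z \<omega>) (x \<omega>) (v \<omega>) (w \<omega>) i n)"
    by auto
  \<comment> \<open>In order: blocks \<open>i\<close> and \<open>Suc i\<close> of \<open>z\<close>
    lie inside the full trajectory, block \<open>i\<close> is inside the current composite state,
    and appending one block gives the next length.\<close>
  have size: "(Suc i - 1 + 1) * m \<le> (k + 1) * m" "(Suc i + 1) * m \<le> (k + 1) * m"
    "(Suc i - 1 + 1) * m \<le> (i + 1) * m" "(Suc i + 1) * m = (i + 1) * m + m"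
    using Suc.prems by (intro mult_le_mono1; simp)+ simp_all
  show ?case
    unfolding ensemble.simps Let_def
  proof (rule conv_vec_analysis[where dH = dH and dH' = dH' and \<H>' = "\<H>' (Suc i)"])
    show "conv_vec P m (\<lambda>\<tau> \<omega>. block m (Suc i) (z \<tau> \<omega>)) (\<lambda>\<omega>. block m (Suc i) (Z \<omega>))"
      by (rule conv_vec_block[OF z size(2)])
    fix n assume n: "n \<in> {1..N}"
    show "conv_vec P (d (Suc i) + m) (\<lambda>\<tau> \<omega>. w \<omega> n (Suc i)) (\<lambda>\<omega>. w \<omega> n (Suc i))"
      using w[OF n i] .
    show "conv_vec P ((Suc i + 1) * m)
      (\<lambda>\<tau> \<omega>. ensemble m d \<M> \<H> \<mu> y R \<gamma> (dM \<tau>) (dH \<tau>) N (z \<tau> \<omega>) (x \<omega>) (v \<omega>) (w \<omega>) i n @\<^sub>v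
        forecast m \<M> \<mu> (dM \<tau>) (Suc i) (z \<tau> \<omega>) (v \<omega> n (Suc i))
          (ensemble m d \<M> \<H> \<mu> y R \<gamma> (dM \<tau>) (dH \<tau>) N (z \<tau> \<omega>) (x \<omega>) (v \<omega>) (w \<omega>) i n))
      (\<lambda>\<omega>. ensemble m d \<M> \<H> \<mu> y R \<gamma> dM' dH' N (Z \<omega>) (x \<omega>) (v \<omega>) (w \<omega>) i n @\<^sub>v
        forecast m \<M> \<mu> dM' (Suc i) (Z \<omega>) (v \<omega> n (Suc i))
          (ensemble m d \<M> \<H> \<mu> y R \<gamma> dM' dH' N (Z \<omega>) (x \<omega>) (v \<omega>) (w \<omega>) i n))"
      unfolding size(4)
    proof (intro conv_vec_append IH n conv_vec_forecast[where \<M>' = "\<M>' (Suc i)"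
            and r = "(k + 1) * m" and s = "(i + 1) * m"])
    qed (use dM[OF i] model[OF i] vectors(1)[OF i] z size v[OF n i] in auto)
  qed (use dH[OF i] obs[OF i] vectors(2)[OF i] R[OF i] \<gamma> Suc.prems(2) in auto)
qed

theorem theorem6p12:
  fixes P :: "'w measure"
    and k m :: nat and d N :: "nat \<Rightarrow> nat"
    and \<M> \<H> :: "nat \<Rightarrow> real vec \<Rightarrow> real vec"
    and \<M>' \<H>' :: "nat \<Rightarrow> real vec \<Rightarrow> real mat"
    and xb x0 :: "real vec" and \<mu> y :: "nat \<Rightarrow> real vec"
    and B :: "real mat" and Q R :: "nat \<Rightarrow> real mat" and \<gamma> :: real
    and X0 :: "nat \<Rightarrow> nat \<Rightarrow> 'w \<Rightarrow> real vec"
    and V W :: "nat \<Rightarrow> nat \<Rightarrow> nat \<Rightarrow> 'w \<Rightarrow> real vec"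
    and j i n :: nat
  assumes prob: "prob_space P"
    and dims: "k \<ge> 1" "m \<ge> 1" "\<And>i. i \<in> {1..k} \<Longrightarrow> d i \<ge> 1"
    and model: "\<And>i. i \<in> {1..k} \<Longrightarrow> C1_map m m (\<M> i) (\<M>' i)"
    and obs: "\<And>i. i \<in> {1..k} \<Longrightarrow> C1_map m (d i) (\<H> i) (\<H>' i)"
    and vectors: "xb \<in> carrier_vec m" "\<And>i. i \<in> {1..k} \<Longrightarrow> \<mu> i \<in> carrier_vec m"
      "\<And>i. i \<in> {1..k} \<Longrightarrow> y i \<in> carrier_vec (d i)"
    and initial: "x0 \<in> carrier_vec ((k + 1) * m)"
    and covs: "pos_semidef m B" "\<And>i. i \<in> {1..k} \<Longrightarrow> pos_semidef m (Q i)"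
      "\<And>i. i \<in> {1..k} \<Longrightarrow> pos_def (d i) (R i)"
    and gamma: "\<gamma> > 0"
    and sizes: "\<And>j. j \<ge> 1 \<Longrightarrow> N j \<ge> 2"
    and X0: "\<And>j n. j \<ge> 1 \<Longrightarrow> n \<ge> 1 \<Longrightarrow> gaussian_vec P m (X0 j n) xb B"
    and V: "\<And>j n i. j \<ge> 1 \<Longrightarrow> n \<ge> 1 \<Longrightarrow> i \<in> {1..k} \<Longrightarrow>
      gaussian_vec P m (V j n i) (0\<^sub>v m) (Q i)"
    and W: "\<And>j n i. j \<ge> 1 \<Longrightarrow> n \<ge> 1 \<Longrightarrow> i \<in> {1..k} \<Longrightarrow>
      gaussian_vec P (d i + m) (W j n i) (0\<^sub>v (d i + m)) (aug_cov m (d i) \<gamma> (R i))"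
    and indep: "prob_space.indep_vars P (\<lambda>a. vec_borel (noise_dim m d a)) (noise X0 V W)
      (noise_indices k)"
    and j: "j \<ge> 1" and i: "i \<le> k" and n: "n \<in> {1..N j}"
  shows "tends_in_prob_at_0 P
    (\<lambda>\<tau> \<omega>. enks_4dvar_member m d \<M> \<H> \<mu> y R \<gamma> \<tau> k N x0
       (\<lambda>j n. X0 j n \<omega>) (\<lambda>j n i. V j n i \<omega>) (\<lambda>j n i. W j n i \<omega>) j i n)
    (\<lambda>\<omega>. lm_enks_member m d \<M> \<H> \<mu> y R \<gamma> \<M>' \<H>' k N x0
       (\<lambda>j n. X0 j n \<omega>) (\<lambda>j n i. V j n i \<omega>) (\<lambda>j n i. W j n i \<omega>) j i n)"
proof -
  interpret prob_space P
    by (rule prob)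
  let ?dM = "\<lambda>\<tau> i. finite_diff \<tau> (\<M> i)" and ?dM' = "\<lambda>i z u. \<M>' i z *\<^sub>v u"
  let ?dH = "\<lambda>\<tau> i. finite_diff \<tau> (aug_obs (\<H> i))" and ?dH' = "\<lambda>i z u. aug_jac m (\<H>' i) z *\<^sub>v u"
  let ?z = "\<lambda>\<tau> \<omega>. iterate m d \<M> \<H> \<mu> y R \<gamma> (?dM \<tau>) (?dH \<tau>) k N x0
    (\<lambda>j n. X0 j n \<omega>) (\<lambda>j n i. V j n i \<omega>) (\<lambda>j n i. W j n i \<omega>)"
  let ?Z = "\<lambda>\<omega>. iterate m d \<M> \<H> \<mu> y R \<gamma> ?dM' ?dH' k N x0
    (\<lambda>j n. X0 j n \<omega>) (\<lambda>j n i. V j n i \<omega>) (\<lambda>j n i. W j n i \<omega>)"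
  \<comment> \<open>Stated for arbitrary converging linearization points and all
    \<open>i \<le> k\<close>: the case \<open>i = k\<close> drives the induction over the iterates,
    and the given \<open>i\<close> yields the claim.\<close>
  have step: "conv_vec P ((i + 1) * m)
      (\<lambda>\<tau> \<omega>. ensemble m d \<M> \<H> \<mu> y R \<gamma> (?dM \<tau>) (?dH \<tau>) (N j) (z \<tau> \<omega>)
        (\<lambda>n. X0 j n \<omega>) (\<lambda>n i. V j n i \<omega>) (\<lambda>n i. W j n i \<omega>) i n)
      (\<lambda>\<omega>. ensemble m d \<M> \<H> \<mu> y R \<gamma> ?dM' ?dH' (N j) (Z \<omega>)
        (\<lambda>n. X0 j n \<omega>) (\<lambda>n i. V j n i \<omega>) (\<lambda>n i. W j n i \<omega>) i n)"
    if "j \<ge> 1" "i \<le> k" "n \<in> {1..N j}" "conv_vec P ((k + 1) * m) z Z" for i j n z Z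
    using that
    by (intro conv_vec_ensemble[where k = k and \<M>' = \<M>' and \<H>' = \<H>']
        conv_vec_finite_diff[OF model] conv_vec_finite_diff_aug_obs[OF obs] model obs vectors(2,3)
        covs(3) gamma gaussian_vec_conv[OF X0] gaussian_vec_conv[OF V] gaussian_vec_conv[OF W]) auto
  \<comment> \<open>Both algorithms start from the same deterministic \<open>x0\<close>; each
    further iterate is the mean of the final ensemble of a pass linearized at the previous
    iterate.\<close>
  have "conv_vec P ((k + 1) * m) (\<lambda>\<tau> \<omega>. ?z \<tau> \<omega> j) (\<lambda>\<omega>. ?Z \<omega> j)" for j
  proof (induction j)
    case 0
    show ?case
      using conv_vec_const[OF initial] by simp
  next
    case (Suc j)
    show ?case
      unfolding iterate.simps by (intro conv_vec_sample_mean step Suc.IH) auto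
  qed
  \<comment> \<open>Pass \<open>j\<close> is linearized at iterate \<open>j - 1\<close>, so the
    convergence of the iterates is used at that index.\<close>
  from conv_vec_imp_tends_in_prob[OF step[OF j i n this]] show ?thesis
    by (simp only: enks_4dvar_member_def lm_enks_member_def analysis_member_def)
qed

end
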